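(* Consider the convex program $\min_x f(x)$ s.t. $g(x)\le 0$, $Ax=b$ and its augmented primal-dual gradient dynamics (Aug-PDGD) with parameter $\rho>0$, as defined in the context, and suppose Assumptions 1, 2 and 3 listed in the context hold. Then there is a family of positive real numbers $M_\beta$ ($\beta>0$), where $M_\beta$ depends only on $\beta$ and on the optimization problem itself (the data $f,g,A,b$), with $\lim_{\beta\to 0^+}M_\beta=1$, such that the following holds. Let $z(t)=(x(t),\lambda(t),\nu(t))$, $t\ge 0$, be any trajectory of the Aug-PDGD with $\lambda(0)\ge 0$, let $d_0=\|z(0)-z^\ast\|$, and let $\beta$ be any strictly positive constant satisfying both $$\beta\le \frac{\kappa\,\delta_{\min}}{46\,\rho\,(L_g^2+\|A\|^2)}$$ and $$\frac{\kappa\mu}{4\beta}-4\beta^2\ \ge\ \|A\|^2+L_g^2+\frac{\kappa}{4}+(\ell+M_\Theta)\left(\mu+M_\Theta+\frac1\rho\right)+\frac{1}{2\rho^2},$$ where $$\delta_{\min}= 1-\left[1+\frac{\rho\cdot\max_{i\in\mathcal I^c}g_i(x^\ast)}{d_0}\right]_+^2 .$$ Then $$\|z(t)-z^\ast\|\le M_\beta\, e^{-\beta t}\,\|z(0)-z^\ast\|\qquad\text{for all } t\ge 0 .$$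
   Context: Notation: $[u]_+=\max\{u,0\}$; $\|\cdot\|$ is the Euclidean norm of vectors and the spectral norm of matrices; vector inequalities are entrywise; $e_i$ is the $i$-th standard basis vector of $\mathbb R^{m_I}$. Problem: $\min_{x\in\mathbb R^n} f(x)$ subject to $g(x)\le 0$ and $Ax=b$, where $f:\mathbb R^n\to\mathbb R$ is continuously differentiable and convex, $g=(g_1,\dots,g_{m_I}):\mathbb R^n\to\mathbb R^{m_I}$ is continuously differentiable with each $g_i$ convex, $A\in\mathbb R^{m_E\times n}$, $b\in\mathbb R^{m_E}$. Aug-PDGD with parameter $\rho>0$: a trajectory is a differentiable curve $z(t)=(x(t),\lambda(t),\nu(t))\in\mathbb R^n\times\mathbb R^{m_I}\times\mathbb R^{m_E}$, $t\ge0$, satisfying for all $t\ge 0$ $$\dot x=-\nabla f(x)-A^T\nu-\sum_{i=1}^{m_I}[\rho g_i(x)+\lambda_i]_+\nabla g_i(x),\qquad \dot\lambda=\sum_{i=1}^{m_I}\frac{[\rho g_i(x)+\lambda_i]_+-\lambda_i}{\rho}e_i,\qquad \dot\nu=Ax-b .$$ Assumption 1: the problem is feasible and $f$ is $\mu$-strongly convex ($\mu>0$). Denote by $x^\ast$ the unique optimal solution, $\mathcal I=\{i: g_i(x^\ast)=0\}$ the active set and $\mathcal I^c=\{1,\dots,m_I\}\setminus\mathcal I$. Let $J$ be the Jacobian matrix of $g$ at $x^\ast$ (row $i$ is $\nabla g_i(x^\ast)^T$), and $J_{\mathcal I}$ the submatrix of rows with index in $\mathcal I$. Assumption 2 (LICQ):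 the rows of $J_{\mathcal I}$ and of $A$ are together linearly independent, and $|\mathcal I|+m_E>0$. Consequently there are unique multipliers $\lambda^\ast,\nu^\ast$ such that $z^\ast=(x^\ast,\lambda^\ast,\nu^\ast)$ satisfies the KKT conditions. Put $$\kappa=\lambda_{\min}\left(\begin{bmatrix}J_{\mathcal I}\\ A\end{bmatrix}\begin{bmatrix}J_{\mathcal I}\\ A\end{bmatrix}^T\right)>0 .$$ For an initial point $z(0)$, $d_0=\|z(0)-z^\ast\|$. Assumption 3: $\nabla f$ is $\ell$-Lipschitz continuous; and for any initial distance $d_0$ there exist $L_{g,i}\ge0$, $M_{g,i}\ge 0$ (chosen non-decreasing as functions of $d_0$) such that, for each $i=1,\dots,m_I$, $\|\nabla g_i(x)\|\le L_{g,i}$ and $\nabla g_i$ is $M_{g,i}$-Lipschitz continuous on $\{x:\|x-x^\ast\|\le d_0\}$. Put $L_g=\sqrt{\sum_i L_{g,i}^2}$, $M_g=\sqrt{\sum_i M_{g,i}^2}$, and $$M_\Theta=\rho L_g^2+(\rho L_g d_0+d_0+\|\lambda^\ast\|)M_g .$$ Convention: in the definition of $\delta_{\min}$, if $\mathcal I^c=\emptyset$ or $d_0=0$ then $\delta_{\min}=1$. *)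

theory Defs
  imports "HOL-Analysis.Analysis" "Jordan_Normal_Form.Char_Poly"
begin

no_notation Matrix.scalar_prod (infix \<open>\<bullet>\<close> 70)
no_notation Matrix.vec_index (infixl \<open>$\<close> 100)

text \<open>
  The numbers \<open>mI\<close> of inequality and \<open>mE\<close> of equality constraints may be zero, whereas the index
  type of a finite Cartesian product is never empty. Vectors of multipliers are therefore functions
  on \<open>nat\<close> of which only the entries below \<open>mI\<close> (resp. \<open>mE\<close>) matter, and the matrix \<open>A\<close> is given
  by its rows \<open>A 0, \<dots>, A (mE - 1)\<close>. The gradient functions \<open>df\<close> and \<open>dg i\<close> are tied
  to \<open>f\<close> and \<open>g i\<close> by \<open>GDERIV\<close>.
\<close>

definition C1_gradient :: "(real^'n \<Rightarrow> real) \<Rightarrow> (real^'n \<Rightarrow> real^'n) \<Rightarrow> bool" where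
  "C1_gradient f df \<longleftrightarrow> (\<forall>x. GDERIV f x :> df x) \<and> continuous_on UNIV df"

definition strongly_convex :: "real \<Rightarrow> (real^'n \<Rightarrow> real) \<Rightarrow> bool" where
  "strongly_convex \<mu> f \<longleftrightarrow>
     (\<forall>x y t. 0 \<le> t \<and> t \<le> 1 \<longrightarrow>
        f ((1 - t) *\<^sub>R x + t *\<^sub>R y)
          \<le> (1 - t) * f x + t * f y - \<mu> / 2 * t * (1 - t) * (norm (x - y))\<^sup>2)"

definition feasible ::
  "nat \<Rightarrow> (nat \<Rightarrow> real^'n \<Rightarrow> real) \<Rightarrow> nat \<Rightarrow> (nat \<Rightarrow> real^'n) \<Rightarrow> (nat \<Rightarrow> real) \<Rightarrow> real^'n \<Rightarrow> bool"
where
  "feasible mI g mE A b x \<longleftrightarrow> (\<forall>i<mI. g i x \<le> 0) \<and> (\<forall>j<mE. A j \<bullet> x = b j)"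

definition optimal_solution ::
  "(real^'n \<Rightarrow> real) \<Rightarrow> nat \<Rightarrow> (nat \<Rightarrow> real^'n \<Rightarrow> real) \<Rightarrow> nat \<Rightarrow> (nat \<Rightarrow> real^'n) \<Rightarrow> (nat \<Rightarrow> real)
    \<Rightarrow> real^'n \<Rightarrow> bool"
where
  "optimal_solution f mI g mE A b x \<longleftrightarrow>
     feasible mI g mE A b x \<and> (\<forall>y. feasible mI g mE A b y \<longrightarrow> f x \<le> f y)"

definition KKT ::
  "(real^'n \<Rightarrow> real^'n) \<Rightarrow> nat \<Rightarrow> (nat \<Rightarrow> real^'n \<Rightarrow> real) \<Rightarrow> (nat \<Rightarrow> real^'n \<Rightarrow> real^'n)
    \<Rightarrow> nat \<Rightarrow> (nat \<Rightarrow> real^'n) \<Rightarrow> (nat \<Rightarrow> real) \<Rightarrow> real^'n \<Rightarrow> (nat \<Rightarrow> real) \<Rightarrow> (nat \<Rightarrow> real) \<Rightarrow> bool"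
where
  "KKT df mI g dg mE A b x lam nu \<longleftrightarrow>
     df x + (\<Sum>i<mI. lam i *\<^sub>R dg i x) + (\<Sum>j<mE. nu j *\<^sub>R A j) = 0
     \<and> feasible mI g mE A b x
     \<and> (\<forall>i<mI. 0 \<le> lam i \<and> lam i * g i x = 0)"

text \<open>The rows of \<open>J\<close> with active index at \<open>x\<close>, followed by the rows of \<open>A\<close>.\<close>

definition active_rows ::
  "nat \<Rightarrow> (nat \<Rightarrow> real^'n \<Rightarrow> real) \<Rightarrow> (nat \<Rightarrow> real^'n \<Rightarrow> real^'n) \<Rightarrow> nat \<Rightarrow> (nat \<Rightarrow> real^'n)
    \<Rightarrow> real^'n \<Rightarrow> (real^'n) list"
where
  "active_rows mI g dg mE A x =
     map (\<lambda>i. dg i x) (filter (\<lambda>i. g i x = 0) [0..<mI]) @ map A [0..<mE]"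

definition LICQ ::
  "nat \<Rightarrow> (nat \<Rightarrow> real^'n \<Rightarrow> real) \<Rightarrow> (nat \<Rightarrow> real^'n \<Rightarrow> real^'n) \<Rightarrow> nat \<Rightarrow> (nat \<Rightarrow> real^'n)
    \<Rightarrow> real^'n \<Rightarrow> bool"
where
  "LICQ mI g dg mE A x \<longleftrightarrow>
     distinct (active_rows mI g dg mE A x) \<and> independent (set (active_rows mI g dg mE A x))
     \<and> card {i. i < mI \<and> g i x = 0} + mE > 0"

text \<open>For a matrix \<open>B\<close> with rows \<open>rs\<close>, the entry \<open>(p, q)\<close> of \<open>B B\<^sup>T\<close> is the inner product of
  the rows \<open>p\<close> and \<open>q\<close>.\<close>

definition gram_mat :: "(real^'n) list \<Rightarrow> real mat" where
  "gram_mat rs = Matrix.mat (length rs) (length rs) (\<lambda>(p, q). rs ! p \<bullet> rs ! q)"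

definition kappa ::
  "nat \<Rightarrow> (nat \<Rightarrow> real^'n \<Rightarrow> real) \<Rightarrow> (nat \<Rightarrow> real^'n \<Rightarrow> real^'n) \<Rightarrow> nat \<Rightarrow> (nat \<Rightarrow> real^'n)
    \<Rightarrow> real^'n \<Rightarrow> real"
where
  "kappa mI g dg mE A x = Min {k. eigenvalue (gram_mat (active_rows mI g dg mE A x)) k}"

text \<open>Spectral norm of \<open>A\<close>: the operator norm of \<open>x \<mapsto> A x\<close>, in which \<open>A x\<close> is replaced by its
  Euclidean norm, as \<^const>\<open>onorm\<close> only depends on the norms of the values.\<close>

definition spectral_norm :: "nat \<Rightarrow> (nat \<Rightarrow> real^'n) \<Rightarrow> real" where
  "spectral_norm mE A = onorm (\<lambda>x. L2_set (\<lambda>j. A j \<bullet> x) {..<mE})"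

definition znorm :: "nat \<Rightarrow> nat \<Rightarrow> real^'n \<Rightarrow> (nat \<Rightarrow> real) \<Rightarrow> (nat \<Rightarrow> real) \<Rightarrow> real" where
  "znorm mI mE x lam nu = sqrt ((norm x)\<^sup>2 + (\<Sum>i<mI. (lam i)\<^sup>2) + (\<Sum>j<mE. (nu j)\<^sup>2))"

definition aug_PDGD ::
  "real \<Rightarrow> (real^'n \<Rightarrow> real^'n) \<Rightarrow> nat \<Rightarrow> (nat \<Rightarrow> real^'n \<Rightarrow> real) \<Rightarrow> (nat \<Rightarrow> real^'n \<Rightarrow> real^'n)
    \<Rightarrow> nat \<Rightarrow> (nat \<Rightarrow> real^'n) \<Rightarrow> (nat \<Rightarrow> real)
    \<Rightarrow> (real \<Rightarrow> real^'n) \<Rightarrow> (real \<Rightarrow> nat \<Rightarrow> real) \<Rightarrow> (real \<Rightarrow> nat \<Rightarrow> real) \<Rightarrow> bool"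
where
  "aug_PDGD \<rho> df mI g dg mE A b x lam nu \<longleftrightarrow>
     (\<forall>t\<ge>0.
        (x has_vector_derivative
           (- df (x t) - (\<Sum>j<mE. nu t j *\<^sub>R A j)
            - (\<Sum>i<mI. max (\<rho> * g i (x t) + lam t i) 0 *\<^sub>R dg i (x t)))) (at t within {0..})
        \<and> (\<forall>i<mI. ((\<lambda>s. lam s i) has_real_derivative
             ((max (\<rho> * g i (x t) + lam t i) 0 - lam t i) / \<rho>)) (at t within {0..}))
        \<and> (\<forall>j<mE. ((\<lambda>s. nu s j) has_real_derivative (A j \<bullet> x t - b j)) (at t within {0..})))"

text \<open>\<open>Lg i d\<close> and \<open>Mg i d\<close> are the constants for the constraint \<open>i\<close> and the distance \<open>d\<close>.\<close>

definition smoothness_constants ::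
  "(real^'n \<Rightarrow> real^'n) \<Rightarrow> nat \<Rightarrow> (nat \<Rightarrow> real^'n \<Rightarrow> real^'n) \<Rightarrow> real^'n
    \<Rightarrow> real \<Rightarrow> (nat \<Rightarrow> real \<Rightarrow> real) \<Rightarrow> (nat \<Rightarrow> real \<Rightarrow> real) \<Rightarrow> bool"
where
  "smoothness_constants df mI dg xs l Lg Mg \<longleftrightarrow>
     l-lipschitz_on UNIV df
     \<and> (\<forall>i<mI. mono_on {0..} (Lg i) \<and> mono_on {0..} (Mg i)
          \<and> (\<forall>d\<ge>0. 0 \<le> Lg i d \<and> 0 \<le> Mg i d
               \<and> (\<forall>x. norm (x - xs) \<le> d \<longrightarrow> norm (dg i x) \<le> Lg i d)
               \<and> (Mg i d)-lipschitz_on {x. norm (x - xs) \<le> d} (dg i)))"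

definition M_Theta :: "real \<Rightarrow> real \<Rightarrow> real \<Rightarrow> real \<Rightarrow> real \<Rightarrow> real" where
  "M_Theta \<rho> L M d0 norm_ls = \<rho> * L\<^sup>2 + (\<rho> * L * d0 + d0 + norm_ls) * M"

definition delta_min ::
  "real \<Rightarrow> nat \<Rightarrow> (nat \<Rightarrow> real^'n \<Rightarrow> real) \<Rightarrow> real^'n \<Rightarrow> real \<Rightarrow> real"
where
  "delta_min \<rho> mI g xs d0 =
     (let Ic = {i. i < mI \<and> g i xs \<noteq> 0} in
      if Ic = {} \<or> d0 = 0 then 1
      else 1 - (max (1 + \<rho> * Max ((\<lambda>i. g i xs) ` Ic) / d0) 0)\<^sup>2)"

end

theory Submission
  imports Defs
begin

text \<open>
  Write \<open>z = (x, \<lambda>, \<nu>)\<close>. Convexity alone shows that \<open>\<parallel>z - z\<^sup>*\<parallel>\<^sup>2 / 2\<close> decreases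
  (\<open>energy_dissipation\<close>): the objective dissipates at least \<open>\<mu> \<parallel>x - x\<^sup>*\<parallel>\<^sup>2\<close>, and every constraint
  \<open>i\<close> dissipates \<open>e\<^sub>i / \<rho>\<close> with \<open>e\<^sub>i \<ge> (u\<^sub>i - \<lambda>\<^sub>i)\<^sup>2\<close> for \<open>u\<^sub>i = [\<rho> g\<^sub>i(x) + \<lambda>\<^sub>i]\<^sub>+\<close>. Hence
  the trajectory stays in the initial ball, where the constants of the gradients of \<open>g\<close> are valid. This
  alone gives no rate, as the errors of the multipliers of the active and of the equality constraints need not
  dissipate anything when \<open>x = x\<^sup>*\<close>.

  These errors act on \<open>x\<close> through \<open>p = J\<^sub>I\<^sup>T (\<lambda> - \<lambda>\<^sup>*)\<^sub>I + A\<^sup>T (\<nu> - \<nu>\<^sup>*)\<close>, the \<open>pull\<close>, and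
  \<open>\<parallel>p\<parallel>\<^sup>2\<close> is at least \<open>\<kappa>\<close> times their square (\<open>kappa_pos_and_le\<close>). As the velocity of \<open>x\<close> equals
  \<open>- p\<close> up to terms paid for by the dissipation (\<open>xdot_decomposition\<close>), the derivative of
  \<open>\<langle>x - x\<^sup>*, p\<rangle>\<close> contributes \<open>- \<parallel>p\<parallel>\<^sup>2\<close>, the missing damping. So
  \<open>V = \<parallel>z - z\<^sup>*\<parallel>\<^sup>2 / 2 + \<epsilon> \<langle>x - x\<^sup>*, p\<rangle>\<close> with \<open>\<epsilon> = 4 \<beta> / \<kappa>\<close>
  satisfies \<open>V' \<le> - 2 \<beta> V\<close> (\<open>lyapunov_decrease\<close>), the accounting being done in \<open>dissipation_budget\<close>.
  The multipliers of inactive constraints do not occur in \<open>p\<close>, but the slack of these constraints makes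
  \<open>e\<^sub>i\<close> at least \<open>\<delta>\<^sub>m\<^sub>i\<^sub>n \<lambda>\<^sub>i\<^sup>2 / 2\<close> (\<open>inactive_damping\<close>).

  Finally \<open>V\<close> differs from \<open>\<parallel>z - z\<^sup>*\<parallel>\<^sup>2 / 2\<close> by a relative amount of at most \<open>r\<close>, the smaller of \<open>1/2\<close> and
  \<open>\<epsilon>\<close> times the Frobenius norm of the matrix with rows \<open>J\<^sub>I\<close> and \<open>A\<close> (\<open>lyapunov_equivalent\<close>). This gives
  the estimate with \<open>M\<^sub>\<beta> = sqrt ((1 + r) / (1 - r))\<close>, which tends to \<open>1\<close> with \<open>\<beta>\<close>.
\<close>

section \<open>The positive part\<close>

text \<open>
  The positive part is monotone and nonexpansive, so its increment \<open>w\<close> over a step \<open>s\<close> lies between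
  \<open>0\<close> and \<open>s\<close>.
\<close>

lemma projection_step_sq_le:
  fixes s c :: real
  shows "(max (s + c) 0 - max c 0)\<^sup>2 \<le> (max (s + c) 0 - max c 0) * s"
proof -
  have "0 \<le> (max (s + c) 0 - max c 0) * (s - (max (s + c) 0 - max c 0))"
  proof (cases "s \<ge> 0")
    case True
    then show ?thesis
      by (intro mult_nonneg_nonneg) auto
  next
    case False
    then show ?thesis
      by (intro mult_nonpos_nonpos) auto
  qed
  then show ?thesis
    by (simp add: power2_eq_square algebra_simps)
qed

text \<open>
  This is where \<open>\<delta>\<^sub>m\<^sub>i\<^sub>n\<close> comes from. For a constraint that is inactive at the optimum, with slack
  \<open>\<eta> = - \<rho> g\<^sub>i(x\<^sup>*)\<close>, the positive part \<open>w\<close> vanishes until the step \<open>s\<close> exceeds \<open>\<eta>\<close>. The right-hand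
  side is, up to the factor \<open>\<rho>\<close>, the energy that this constraint dissipates. Over all \<open>s\<close> it is at least
  \<open>lam\<^sup>2\<close> or, when \<open>lam > \<eta> / 2\<close>, at least its value \<open>lam \<eta> - \<eta>\<^sup>2 / 4\<close> at \<open>s = lam + \<eta> / 2\<close>. So the
  multiplier is damped whatever \<open>s\<close> is, and \<open>lam \<le> d\<close> makes the damping proportional to \<open>lam\<^sup>2\<close>.
\<close>

lemma inactive_damping:
  fixes s \<eta> lam d :: real
  assumes eta: "\<eta> > 0" and lam: "0 \<le> lam" "lam \<le> d" and d: "d > 0"
  defines "w \<equiv> max (s - \<eta>) 0"
  shows "(1 - (max (1 - \<eta> / d) 0)\<^sup>2) / 2 * lam\<^sup>2 \<le> w * s - 2 * lam * w + lam\<^sup>2"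
proof -
  define \<delta> where "\<delta> = 1 - (max (1 - \<eta> / d) 0)\<^sup>2"
  have \<delta>1: "\<delta> / 2 * lam\<^sup>2 \<le> 1 * lam\<^sup>2"
    unfolding \<delta>_def by (intro mult_right_mono) (auto intro: order_trans[of _ 0])
  show ?thesis
  proof (cases "s \<le> \<eta> \<or> lam \<le> \<eta> / 2")
    case True
    then have "0 \<le> w * (s - 2 * lam)"
      unfolding w_def using eta by (cases "s \<le> \<eta>") (auto simp: max_def)
    moreover have "w * s - 2 * lam * w = w * (s - 2 * lam)"
      by (simp add: algebra_simps)
    ultimately show ?thesis
      using \<delta>1 by (simp add: \<delta>_def)
  next
    case False
    then have w: "w = s - \<eta>" and lam2: "\<eta> / 2 < lam"
      by (auto simp: w_def)
    have "w * s - 2 * lam * w + lam\<^sup>2 = (w - (lam - \<eta> / 2))\<^sup>2 + (lam * \<eta> - \<eta>\<^sup>2 / 4)"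
      unfolding w by (simp add: power2_eq_square algebra_simps)
    then have "lam * \<eta> - \<eta>\<^sup>2 / 4 \<le> w * s - 2 * lam * w + lam\<^sup>2"
      by simp
    moreover have "\<delta> / 2 * lam\<^sup>2 \<le> lam * \<eta> - \<eta>\<^sup>2 / 4"
    proof (cases "\<eta> \<le> d")
      case True
      define y where "y = \<eta> / d"
      have y: "0 < y" "y \<le> 1" "\<eta> = y * d"
        using True eta d by (auto simp: y_def)
      have \<delta>y: "\<delta> = 2 * y - y\<^sup>2"
        using y(2) by (simp add: \<delta>_def y_def[symmetric] power2_eq_square algebra_simps)
      have "\<delta> / 2 * lam\<^sup>2 \<le> y * lam\<^sup>2 - y\<^sup>2 / 4 * lam\<^sup>2"
        using mult_right_mono[of "y\<^sup>2 / 4" "y\<^sup>2 / 2" "lam\<^sup>2"] unfolding \<delta>y by (simp add: algebra_simps diff_divide_distrib)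
      also have "\<dots> = y * (lam\<^sup>2 * (1 - y / 4))"
        by (simp add: power2_eq_square algebra_simps)
      also have "\<dots> \<le> y * (lam * d - y * d\<^sup>2 / 4)"
      proof -
        have "0 \<le> (d - lam) * (lam - y / 4 * (d + lam))"
        proof (rule mult_nonneg_nonneg)
          have "y / 4 * (d + lam) = \<eta> / 4 + y * lam / 4"
            using y(3) by (simp add: algebra_simps)
          also have "\<dots> \<le> \<eta> / 4 + lam / 4"
            using mult_right_mono[OF y(2) lam(1)] by simp
          finally show "0 \<le> lam - y / 4 * (d + lam)"
            using lam2 lam(1) by linarith
        qed (use lam in simp)
        then have "lam\<^sup>2 * (1 - y / 4) \<le> lam * d - y * d\<^sup>2 / 4"
          by (simp add: power2_eq_square algebra_simps diff_divide_distrib add_divide_distrib)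
        then show ?thesis
          using y(1) by (intro mult_left_mono) auto
      qed
      also have "\<dots> = lam * \<eta> - \<eta>\<^sup>2 / 4"
        unfolding y(3) by (simp add: power2_eq_square algebra_simps)
      finally show ?thesis .
    next
      case False
      then have \<delta>2: "\<delta> = 1"
        using d by (simp add: \<delta>_def max_def)
      \<comment> \<open>Here \<open>\<eta>\<close> lies between the roots \<open>lam\<close> and \<open>2 lam\<close> of this quadratic.\<close>
      have "0 \<le> (\<eta> - lam) * (2 * lam - \<eta>)"
        using lam2 False lam by (intro mult_nonneg_nonneg) auto
      moreover have "0 \<le> lam * \<eta>"
        using lam eta by simp
      ultimately show ?thesis
        unfolding \<delta>2 by (simp add: power2_eq_square algebra_simps)
    qed
    ultimately show ?thesis
      by (simp add: \<delta>_def)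
  qed
qed

section \<open>Convex functions and their gradients\<close>

lemma convex_imp_strongly_convex_0:
  fixes f :: "real^'n \<Rightarrow> real"
  assumes "convex_on UNIV f"
  shows "strongly_convex 0 f"
  unfolding strongly_convex_def using convex_onD[OF assms] by auto

lemma GDERIV_line:
  fixes f :: "real^'n \<Rightarrow> real"
  assumes "GDERIV f (x + t *\<^sub>R h) :> D"
  shows "((\<lambda>t. f (x + t *\<^sub>R h)) has_real_derivative h \<bullet> D) (at t within S)"
proof -
  have "((\<lambda>t. x + t *\<^sub>R h) has_derivative (\<lambda>s. s *\<^sub>R h)) (at t within S)"
    by (auto intro!: derivative_eq_intros)
  from has_derivative_compose[OF this] assms
  have "((\<lambda>t. f (x + t *\<^sub>R h)) has_derivative (\<lambda>s. (s *\<^sub>R h) \<bullet> D)) (at t within S)"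
    unfolding gderiv_def by blast
  then show ?thesis
    by (simp add: has_field_derivative_def mult_commute_abs)
qed

text \<open>
  Stated for every modulus, \<open>\<mu> = 0\<close> included, so that it serves the objective and the merely convex
  constraints alike. Divide the inequality of strong convexity by \<open>t\<close> and let \<open>t\<close> tend to \<open>0\<close>.
\<close>

lemma strongly_convex_above_tangent:
  fixes f :: "real^'n \<Rightarrow> real"
  assumes sc: "strongly_convex \<mu> f" and D: "GDERIV f x :> D"
  shows "f x + (y - x) \<bullet> D + \<mu> / 2 * (norm (y - x))\<^sup>2 \<le> f y"
proof -
  define h where "h = y - x"
  have "((\<lambda>t. f (x + t *\<^sub>R h)) has_real_derivative h \<bullet> D) (at 0)"
    using GDERIV_line[of f x 0 h D UNIV] D by simp
  then have "((\<lambda>t. (f (x + t *\<^sub>R h) - f x) / t) \<longlongrightarrow> h \<bullet> D) (at 0)"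
    by (simp add: DERIV_def)
  then have lim_quot: "((\<lambda>t. (f (x + t *\<^sub>R h) - f x) / t) \<longlongrightarrow> h \<bullet> D) (at_right 0)"
    by (simp add: filterlim_at_split)
  have lim_bound: "((\<lambda>t. f y - f x - \<mu> / 2 * (1 - t) * (norm h)\<^sup>2) \<longlongrightarrow> f y - f x - \<mu> / 2 * (1 - 0) * (norm h)\<^sup>2) (at_right 0)"
    by (intro tendsto_intros)
  have quot_le: "\<forall>\<^sub>F t in at_right 0. (f (x + t *\<^sub>R h) - f x) / t \<le> f y - f x - \<mu> / 2 * (1 - t) * (norm h)\<^sup>2"
  proof -
    have "(f (x + t *\<^sub>R h) - f x) / t \<le> f y - f x - \<mu> / 2 * (1 - t) * (norm h)\<^sup>2" if "0 < t" "t < 1" for t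
    proof -
      have "f ((1 - t) *\<^sub>R x + t *\<^sub>R y) \<le> (1 - t) * f x + t * f y - \<mu> / 2 * t * (1 - t) * (norm (x - y))\<^sup>2"
        using sc that unfolding strongly_convex_def by simp
      moreover have "(1 - t) *\<^sub>R x + t *\<^sub>R y = x + t *\<^sub>R h"
        by (simp add: h_def algebra_simps)
      ultimately have "f (x + t *\<^sub>R h) - f x \<le> (f y - f x - \<mu> / 2 * (1 - t) * (norm h)\<^sup>2) * t"
        by (simp add: h_def norm_minus_commute algebra_simps)
      then show ?thesis
        using that by (simp add: pos_divide_le_eq)
    qed
    then show ?thesis
      unfolding eventually_at_right_field by (intro exI[of _ 1]) auto
  qed
  have "h \<bullet> D \<le> f y - f x - \<mu> / 2 * (1 - 0) * (norm h)\<^sup>2"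
    by (rule tendsto_le[OF trivial_limit_at_right_real lim_bound lim_quot quot_le])
  then show ?thesis
    by (simp add: h_def)
qed

lemma strongly_convex_gradient_monotone:
  fixes f :: "real^'n \<Rightarrow> real"
  assumes sc: "strongly_convex \<mu> f" and D: "GDERIV f x :> Dx" "GDERIV f y :> Dy"
  shows "\<mu> * (norm (x - y))\<^sup>2 \<le> (x - y) \<bullet> (Dx - Dy)"
  using strongly_convex_above_tangent[OF sc D(1), of y] strongly_convex_above_tangent[OF sc D(2), of x]
  by (simp add: norm_minus_commute[of y x] algebra_simps inner_diff_left inner_diff_right)

lemma lipschitz_gradient_upper_bound:
  fixes f :: "real^'n \<Rightarrow> real"
  assumes D: "\<And>x. GDERIV f x :> df x" and lip: "l-lipschitz_on UNIV df"
  shows "f (x + h) \<le> f x + h \<bullet> df x + l / 2 * (norm h)\<^sup>2"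
proof -
  define \<phi> where "\<phi> = (\<lambda>t. f (x + t *\<^sub>R h) - t * (h \<bullet> df x) - l / 2 * t\<^sup>2 * (norm h)\<^sup>2)"
  have der: "(\<phi> has_real_derivative (h \<bullet> df (x + t *\<^sub>R h) - h \<bullet> df x - l * t * (norm h)\<^sup>2)) (at t)" for t
    unfolding \<phi>_def by (auto intro!: derivative_eq_intros GDERIV_line D simp: power2_eq_square)
  have "\<phi> 1 \<le> \<phi> 0"
  proof (rule DERIV_nonpos_imp_nonincreasing[of 0 1 \<phi>])
    fix t :: real assume t: "0 \<le> t" "t \<le> 1"
    have "h \<bullet> (df (x + t *\<^sub>R h) - df x) \<le> norm h * norm (df (x + t *\<^sub>R h) - df x)"
      by (rule norm_cauchy_schwarz)
    also have "\<dots> \<le> norm h * (l * norm (t *\<^sub>R h))"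
      using lipschitz_onD[OF lip, of "x + t *\<^sub>R h" x] by (intro mult_left_mono) (auto simp: dist_norm)
    also have "\<dots> = l * t * (norm h)\<^sup>2"
      using t by (simp add: power2_eq_square)
    finally have "h \<bullet> df (x + t *\<^sub>R h) - h \<bullet> df x - l * t * (norm h)\<^sup>2 \<le> 0"
      by (simp add: inner_diff_right)
    then show "\<exists>d. DERIV \<phi> t :> d \<and> d \<le> 0"
      using der by blast
  qed simp
  then show ?thesis
    by (simp add: \<phi>_def)
qed

text \<open>
  Take a gradient step of length \<open>1 / l\<close> from \<open>y\<close> on the function \<open>f\<close> minus its tangent at \<open>x\<close>: the
  descent is at least \<open>\<parallel>\<nabla>f(y) - \<nabla>f(x)\<parallel>\<^sup>2 / (2 l)\<close>, and the tilted function never falls below its value at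
  \<open>x\<close>. Adding the inequality with \<open>x\<close> and \<open>y\<close> exchanged gives the claim.
\<close>

lemma gradient_cocoercive:
  fixes f :: "real^'n \<Rightarrow> real"
  assumes cv: "convex_on UNIV f" and D: "\<And>x. GDERIV f x :> df x"
    and lip: "l-lipschitz_on UNIV df" and l: "l > 0"
  shows "(norm (df x - df y))\<^sup>2 \<le> l * ((x - y) \<bullet> (df x - df y))"
proof -
  have half: "(norm (df y - df x))\<^sup>2 / (2 * l) \<le> f y - f x - (y - x) \<bullet> df x" for x y
  proof -
    define G where "G = df y - df x"
    define h where "h = - (1 / l) *\<^sub>R G"
    have "f x + (y + h - x) \<bullet> df x \<le> f (y + h)"
      using strongly_convex_above_tangent[OF convex_imp_strongly_convex_0[OF cv] D, of x "y + h"] by simp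
    also have "\<dots> \<le> f y + h \<bullet> df y + l / 2 * (norm h)\<^sup>2"
      by (rule lipschitz_gradient_upper_bound[OF D lip])
    finally have "0 \<le> f y - f x - (y - x) \<bullet> df x + h \<bullet> G + l / 2 * (norm h)\<^sup>2"
      by (simp add: G_def inner_diff_left inner_diff_right inner_add_left algebra_simps)
    moreover have "h \<bullet> G = - ((norm G)\<^sup>2 / l)"
      by (simp add: h_def power2_norm_eq_inner)
    moreover have "l / 2 * (norm h)\<^sup>2 = (norm G)\<^sup>2 / (2 * l)"
      using l by (simp add: h_def power_mult_distrib power_divide power2_eq_square field_simps)
    moreover have "(norm G)\<^sup>2 / l = 2 * ((norm G)\<^sup>2 / (2 * l))"
      by simp
    ultimately show ?thesis
      by (simp add: G_def)
  qed
  have "(norm (df x - df y))\<^sup>2 / l \<le> (x - y) \<bullet> (df x - df y)"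
    using half[of x y] half[of y x] l
    by (simp add: norm_minus_commute[of "df y"] inner_diff_left inner_diff_right field_simps)
  then show ?thesis
    using l by (simp add: field_simps)
qed

section \<open>The least eigenvalue of a Gram matrix\<close>

lemma compact_coordinate_sphere:
  "compact {c :: nat \<Rightarrow> real. (\<forall>p\<ge>n. c p = 0) \<and> (\<Sum>p<n. (c p)\<^sup>2) = 1}"
proof -
  define K :: "(nat \<Rightarrow> real) set" where "K = PiE UNIV (\<lambda>p. if p < n then {-1..1} else {0})"
  have "compact K"
    using compactin_PiE[of "\<lambda>_. euclidean" UNIV "\<lambda>p. if p < n then {-1..1::real} else {0}"]
    by (auto simp: K_def euclidean_product_topology)
  moreover have "closed {c :: nat \<Rightarrow> real. (\<Sum>p<n. (c p)\<^sup>2) = 1}"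
    by (intro closed_Collect_eq continuous_intros) auto
  ultimately have "compact (K \<inter> {c. (\<Sum>p<n. (c p)\<^sup>2) = 1})"
    by (rule compact_Int_closed)
  moreover have "K \<inter> {c. (\<Sum>p<n. (c p)\<^sup>2) = 1} = {c. (\<forall>p\<ge>n. c p = 0) \<and> (\<Sum>p<n. (c p)\<^sup>2) = 1}"
  proof -
    have "c p \<in> {-1..1}" if "(\<Sum>p<n. (c p)\<^sup>2) = 1" "p < n" for c :: "nat \<Rightarrow> real" and p
    proof -
      have "(c p)\<^sup>2 \<le> (\<Sum>p<n. (c p)\<^sup>2)"
        using that by (intro member_le_sum) auto
      then have "\<bar>c p\<bar> \<le> 1"
        using that by (simp add: abs_square_le_1)
      then show ?thesis
        by auto
    qed
    then show ?thesis
      by (auto simp: K_def PiE_iff split: if_splits)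
  qed
  ultimately show ?thesis
    by simp
qed

text \<open>
  First-order optimality for a quadratic polynomial that is minimal at \<open>0\<close>.
\<close>

lemma nonneg_parabola_tangent:
  fixes \<alpha> \<gamma> :: real
  assumes "\<And>t. 0 \<le> 2 * \<alpha> * t + \<gamma> * t\<^sup>2"
  shows "\<alpha> = 0"
proof (rule ccontr)
  assume "\<alpha> \<noteq> 0"
  define k where "k = \<bar>\<gamma>\<bar> + 1"
  have k: "k > 0" "\<gamma> < 2 * k"
    by (auto simp: k_def)
  have "0 \<le> 2 * \<alpha> * (- \<alpha> / k) + \<gamma> * (- \<alpha> / k)\<^sup>2"
    by (rule assms)
  also have "\<dots> = (\<alpha> / k)\<^sup>2 * (\<gamma> - 2 * k)"
    using k by (simp add: power2_eq_square field_simps)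
  also have "\<dots> < 0"
    using k \<open>\<alpha> \<noteq> 0\<close> by (intro mult_pos_neg) auto
  finally show False
    by simp
qed

lemma gram_mat_mult_vec:
  assumes "v \<in> carrier_vec (length rs)" "p < length rs"
  shows "Matrix.vec_index (gram_mat rs *\<^sub>v v) p
    = rs ! p \<bullet> (\<Sum>q<length rs. Matrix.vec_index v q *\<^sub>R rs ! q)"
  using assms by (auto simp: gram_mat_def Matrix.scalar_prod_def inner_sum_right atLeast0LessThan mult.commute
      intro!: sum.cong)

lemma finite_eigenvalues_gram_mat: "finite {k. eigenvalue (gram_mat rs) k}"
proof -
  have A: "gram_mat rs \<in> carrier_mat (length rs) (length rs)"
    by (simp add: gram_mat_def)
  have "char_poly (gram_mat rs) \<noteq> 0"
    using degree_monic_char_poly[OF A] by auto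
  from poly_roots_finite[OF this] show ?thesis
    by (simp add: eigenvalue_root_char_poly[OF A])
qed

text \<open>
  Rayleigh's variational argument: the squared norm of the combination of the rows attains its minimum
  \<open>m\<close> over the compact unit sphere of coefficient vectors, and stationarity of the minimizer in each
  coordinate direction is the eigenvector equation.
\<close>

lemma gram_mat_minimal_eigenvalue:
  fixes rs :: "(real^'n) list"
  assumes "rs \<noteq> []"
  obtains m where "eigenvalue (gram_mat rs) m"
    and "\<And>c. m * (\<Sum>p<length rs. (c p)\<^sup>2) \<le> (norm (\<Sum>p<length rs. c p *\<^sub>R rs ! p))\<^sup>2"
proof -
  define n where "n = length rs"
  define N :: "(nat \<Rightarrow> real) \<Rightarrow> real" where "N c = (\<Sum>p<n. (c p)\<^sup>2)" for c
  define F where "F c = (\<Sum>p<n. c p *\<^sub>R rs ! p)" for c :: "nat \<Rightarrow> real"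
  define S where "S = {c :: nat \<Rightarrow> real. (\<forall>p\<ge>n. c p = 0) \<and> N c = 1}"
  have n: "n > 0"
    using assms by (simp add: n_def)
  have "compact S"
    unfolding S_def N_def by (rule compact_coordinate_sphere)
  moreover have "(\<lambda>p. if p = 0 then 1 else 0) \<in> S"
    using n by (simp add: S_def N_def if_distrib[of "\<lambda>x. x\<^sup>2"] cong: if_cong)
  then have "S \<noteq> {}"
    by blast
  moreover have "continuous_on S (\<lambda>c. (norm (F c))\<^sup>2)"
    unfolding F_def by (intro continuous_intros) (auto intro: continuous_on_subset[OF continuous_on_product_coordinates])
  ultimately obtain c0 where c0: "c0 \<in> S" and min: "\<And>c. c \<in> S \<Longrightarrow> (norm (F c0))\<^sup>2 \<le> (norm (F c))\<^sup>2"
    using continuous_attains_inf by metis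
  define m where "m = (norm (F c0))\<^sup>2"
  have N0: "N c0 = 1"
    using c0 by (simp add: S_def)
  have bound: "m * N c \<le> (norm (F c))\<^sup>2" for c
  proof (cases "N c = 0")
    case False
    then have pos: "N c > 0"
      by (simp add: N_def sum_nonneg less_le)
    define k where "k = 1 / sqrt (N c)"
    have k2: "k\<^sup>2 * N c = 1"
      using pos by (simp add: k_def power_divide)
    define c' where "c' = (\<lambda>p. if p < n then k * c p else 0)"
    have "N c' = k\<^sup>2 * N c"
      by (simp add: N_def c'_def power_mult_distrib sum_distrib_left)
    then have "c' \<in> S"
      using k2 by (simp add: S_def) (simp add: c'_def)
    moreover have "F c' = k *\<^sub>R F c"
      by (simp add: F_def c'_def scaleR_sum_right)
    ultimately have "m \<le> k\<^sup>2 * (norm (F c))\<^sup>2"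
      using min[of c'] by (simp add: m_def power_mult_distrib)
    then have "m * N c \<le> k\<^sup>2 * (norm (F c))\<^sup>2 * N c"
      using pos by (intro mult_right_mono) auto
    also have "\<dots> = (k\<^sup>2 * N c) * (norm (F c))\<^sup>2"
      by (simp add: algebra_simps)
    finally show ?thesis
      by (simp add: k2)
  qed simp
  \<comment> \<open>Perturbing the minimizer by \<open>t\<close> in the coordinate \<open>q\<close> keeps the form nonnegative, so the linear term in \<open>t\<close> vanishes.\<close>
  have stationary: "rs ! q \<bullet> F c0 = m * c0 q" if q: "q < n" for q
  proof -
    have "0 \<le> 2 * (rs ! q \<bullet> F c0 - m * c0 q) * t + ((norm (rs ! q))\<^sup>2 - m) * t\<^sup>2" for t
    proof -
      define c where "c = (\<lambda>p. c0 p + (if p = q then t else 0))"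
      have Fc: "F c = F c0 + t *\<^sub>R rs ! q"
        using q by (simp add: F_def c_def scaleR_add_left sum.distrib if_distrib[of "\<lambda>x. x *\<^sub>R _"] cong: if_cong)
      have "N c = (\<Sum>p<n. (c0 p)\<^sup>2 + (if p = q then 2 * t * c0 q + t\<^sup>2 else 0))"
        unfolding N_def c_def by (intro sum.cong) (auto simp: power2_eq_square algebra_simps)
      also have "\<dots> = 1 + 2 * t * c0 q + t\<^sup>2"
        using q N0 by (simp add: sum.distrib N_def)
      finally have Nc: "N c = 1 + 2 * t * c0 q + t\<^sup>2" .
      have "(norm (F c))\<^sup>2 = m + 2 * t * (rs ! q \<bullet> F c0) + t\<^sup>2 * (norm (rs ! q))\<^sup>2"
        unfolding Fc m_def power2_norm_eq_inner
        by (simp add: inner_add_left inner_add_right inner_commute power2_eq_square algebra_simps)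
      then show ?thesis
        using bound[of c] unfolding Nc by (simp add: algebra_simps)
    qed
    then have "rs ! q \<bullet> F c0 - m * c0 q = 0"
      by (rule nonneg_parabola_tangent)
    then show ?thesis
      by simp
  qed
  define v where "v = Matrix.vec n c0"
  have v: "v \<in> carrier_vec n"
    by (simp add: v_def)
  have Fv: "(\<Sum>q<n. Matrix.vec_index v q *\<^sub>R rs ! q) = F c0"
    by (simp add: F_def v_def)
  have "v \<noteq> 0\<^sub>v n"
  proof
    assume "v = 0\<^sub>v n"
    then have "c0 p = 0" if "p < n" for p
      using that by (metis index_vec index_zero_vec(1) v_def)
    then have "N c0 = 0"
      by (simp add: N_def)
    then show False
      using N0 by simp
  qed
  moreover have "gram_mat rs *\<^sub>v v = m \<cdot>\<^sub>v v"
  proof (rule eq_vecI)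
    fix p assume "p < dim_vec (m \<cdot>\<^sub>v v)"
    then have p: "p < n"
      by (simp add: v_def)
    show "Matrix.vec_index (gram_mat rs *\<^sub>v v) p = Matrix.vec_index (m \<cdot>\<^sub>v v) p"
      using gram_mat_mult_vec[of v rs p] v p Fv stationary[OF p] by (simp add: n_def[symmetric]) (simp add: v_def)
  qed (simp add: v_def gram_mat_def n_def)
  ultimately have "eigenvalue (gram_mat rs) m"
    unfolding eigenvalue_def eigenvector_def using v by (auto simp: gram_mat_def n_def)
  then show ?thesis
    using that bound by (simp add: N_def F_def n_def)
qed

text \<open>
  For an eigenvector \<open>v\<close> the number \<open>k \<parallel>v\<parallel>\<^sup>2\<close> is the squared norm of the combination of the rows with
  coefficients \<open>v\<close>, which is nonzero by independence.
\<close>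

lemma gram_mat_eigenvalue_pos:
  fixes rs :: "(real^'n) list"
  assumes dist: "distinct rs" and ind: "independent (set rs)" and k: "eigenvalue (gram_mat rs) k"
  shows "k > 0"
proof -
  define n where "n = length rs"
  obtain v where v: "v \<in> carrier_vec n" "v \<noteq> 0\<^sub>v n" and ev: "gram_mat rs *\<^sub>v v = k \<cdot>\<^sub>v v"
    using k unfolding eigenvalue_def eigenvector_def by (auto simp: gram_mat_def n_def)
  define c where "c = (\<lambda>p. Matrix.vec_index v p)"
  define F where "F = (\<Sum>q<n. c q *\<^sub>R rs ! q)"
  have row: "rs ! p \<bullet> F = k * c p" if "p < n" for p
    using gram_mat_mult_vec[of v rs p] that v ev by (simp add: n_def c_def F_def)
  obtain q where q: "q < n" "c q \<noteq> 0"
    using v by (metis c_def carrier_vecD eq_vecI index_zero_vec)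
  have pos: "(\<Sum>p<n. (c p)\<^sup>2) > 0"
    using q by (intro sum_pos2[of _ q]) auto
  have "k * (\<Sum>p<n. (c p)\<^sup>2) = (\<Sum>p<n. c p * (rs ! p \<bullet> F))"
    unfolding sum_distrib_left by (intro sum.cong) (auto simp: row power2_eq_square)
  also have "\<dots> = F \<bullet> F"
    by (subst (2) F_def) (simp add: inner_sum_left)
  finally have eq: "k * (\<Sum>p<n. (c p)\<^sup>2) = F \<bullet> F" .
  have "F \<noteq> 0"
  proof
    assume "F = 0"
    define u where "u = (\<lambda>r. c (the_inv_into {..<n} ((!) rs) r))"
    have inj: "inj_on ((!) rs) {..<n}"
      using dist by (simp add: inj_on_nth n_def)
    have im: "(!) rs ` {..<n} = set rs"
      by (auto simp: n_def in_set_conv_nth)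
    have "(\<Sum>r\<in>set rs. u r *\<^sub>R r) = (\<Sum>p<n. u (rs ! p) *\<^sub>R rs ! p)"
      unfolding im[symmetric] using inj by (simp add: sum.reindex)
    also have "\<dots> = F"
      unfolding F_def by (intro sum.cong) (auto simp: u_def the_inv_into_f_f[OF inj])
    finally have "(\<Sum>r\<in>set rs. u r *\<^sub>R r) = 0"
      using \<open>F = 0\<close> by simp
    moreover have "u (rs ! q) \<noteq> 0" "rs ! q \<in> set rs"
      using q the_inv_into_f_f[OF inj, of q] by (auto simp: u_def n_def)
    ultimately show False
      using ind dependent_finite[OF finite_set, of rs] by blast
  qed
  then have "k * (\<Sum>p<n. (c p)\<^sup>2) > 0"
    by (simp add: eq)
  then show ?thesis
    using pos by (simp add: zero_less_mult_iff)
qed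

lemma sum_nth_append:
  "(\<Sum>p<length (xs @ ys). h p ((xs @ ys) ! p))
    = (\<Sum>p<length xs. h p (xs ! p)) + (\<Sum>q<length ys. h (length xs + q) (ys ! q))"
  for h :: "nat \<Rightarrow> 'a \<Rightarrow> 'b :: comm_monoid_add"
proof -
  have split: "(\<Sum>p<m + n. F p) = (\<Sum>p<m. F p) + (\<Sum>q<n. F (m + q))" for F :: "nat \<Rightarrow> 'b" and m n
    by (induction n) (auto simp: add.assoc)
  show ?thesis
    by (simp add: split nth_append)
qed

text \<open>
  The only two properties of \<open>\<kappa>\<close> that the convergence proof draws on: being the least eigenvalue of a
  Gram matrix of independent rows, it is positive, and it bounds the quadratic form from below.
\<close>

lemma kappa_pos_and_le:
  fixes g :: "nat \<Rightarrow> real^'n \<Rightarrow> real"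
  assumes L: "LICQ mI g dg mE A x"
  defines "act \<equiv> {i. i < mI \<and> g i x = 0}"
  shows "kappa mI g dg mE A x > 0"
    and "kappa mI g dg mE A x * ((\<Sum>i\<in>act. (y i)\<^sup>2) + (\<Sum>j<mE. (v j)\<^sup>2))
      \<le> (norm ((\<Sum>i\<in>act. y i *\<^sub>R dg i x) + (\<Sum>j<mE. v j *\<^sub>R A j)))\<^sup>2"
proof -
  define rs where "rs = active_rows mI g dg mE A x"
  define il where "il = filter (\<lambda>i. g i x = 0) [0..<mI]"
  have rs: "rs = map (\<lambda>i. dg i x) il @ map A [0..<mE]"
    by (simp add: rs_def active_rows_def il_def)
  have il: "distinct il" "set il = act"
    by (auto simp: il_def act_def)
  have "length rs = card act + mE"
    using il distinct_card[of il] by (simp add: rs)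
  then have "length rs > 0"
    using L by (simp add: LICQ_def act_def)
  then have ne: "rs \<noteq> []"
    by simp
  have kap: "kappa mI g dg mE A x = Min {k. eigenvalue (gram_mat rs) k}"
    by (simp add: kappa_def rs_def)
  obtain m where m: "eigenvalue (gram_mat rs) m"
    and bound: "\<And>c. m * (\<Sum>p<length rs. (c p)\<^sup>2) \<le> (norm (\<Sum>p<length rs. c p *\<^sub>R rs ! p))\<^sup>2"
    using gram_mat_minimal_eigenvalue[OF ne] by blast
  have "eigenvalue (gram_mat rs) (kappa mI g dg mE A x)"
    using Min_in[OF finite_eigenvalues_gram_mat[of rs]] m unfolding kap by blast
  then show "kappa mI g dg mE A x > 0"
    using gram_mat_eigenvalue_pos[of rs] L by (auto simp: LICQ_def rs_def)
  have le: "kappa mI g dg mE A x \<le> m"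
    unfolding kap using m by (intro Min_le finite_eigenvalues_gram_mat) auto
  define c where "c = (\<lambda>p. if p < length il then y (il ! p) else v (p - length il))"
  have over_il: "(\<Sum>p<length il. h (il ! p)) = (\<Sum>i\<in>act. h i)" for h :: "nat \<Rightarrow> 'c :: comm_monoid_add"
    using sum.reindex_bij_betw[OF bij_betw_nth[OF il(1) refl il(2)[symmetric]], of h] by simp
  have "(\<Sum>p<length rs. (c p)\<^sup>2) = (\<Sum>p<length il. (y (il ! p))\<^sup>2) + (\<Sum>j<mE. (v j)\<^sup>2)"
    unfolding rs using sum_nth_append[of "\<lambda>p _. (c p)\<^sup>2" "map (\<lambda>i. dg i x) il" "map A [0..<mE]"] by (simp add: c_def)
  then have N: "(\<Sum>p<length rs. (c p)\<^sup>2) = (\<Sum>i\<in>act. (y i)\<^sup>2) + (\<Sum>j<mE. (v j)\<^sup>2)"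
    by (simp add: over_il[of "\<lambda>i. (y i)\<^sup>2"])
  have "(\<Sum>p<length rs. c p *\<^sub>R rs ! p) = (\<Sum>p<length il. y (il ! p) *\<^sub>R dg (il ! p) x) + (\<Sum>j<mE. v j *\<^sub>R A j)"
    unfolding rs using sum_nth_append[of "\<lambda>p r. c p *\<^sub>R r" "map (\<lambda>i. dg i x) il" "map A [0..<mE]"] by (simp add: c_def)
  then have F: "(\<Sum>p<length rs. c p *\<^sub>R rs ! p) = (\<Sum>i\<in>act. y i *\<^sub>R dg i x) + (\<Sum>j<mE. v j *\<^sub>R A j)"
    by (simp add: over_il[of "\<lambda>i. y i *\<^sub>R dg i x"])
  have "kappa mI g dg mE A x * (\<Sum>p<length rs. (c p)\<^sup>2) \<le> m * (\<Sum>p<length rs. (c p)\<^sup>2)"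
    using le by (intro mult_right_mono sum_nonneg) auto
  then show "kappa mI g dg mE A x * ((\<Sum>i\<in>act. (y i)\<^sup>2) + (\<Sum>j<mE. (v j)\<^sup>2))
      \<le> (norm ((\<Sum>i\<in>act. y i *\<^sub>R dg i x) + (\<Sum>j<mE. v j *\<^sub>R A j)))\<^sup>2"
    using bound[of c] unfolding N F by linarith
qed

section \<open>The spectral norm\<close>

text \<open>
  The function under \<^const>\<open>onorm\<close> is not linear, so the supremum must be shown to be finite by hand.
\<close>

lemma spectral_norm_bound:
  fixes A :: "nat \<Rightarrow> real^'n"
  shows "L2_set (\<lambda>j. A j \<bullet> x) {..<mE} \<le> spectral_norm mE A * norm x"
proof (cases "x = 0")
  case False
  let ?h = "\<lambda>x. L2_set (\<lambda>j. A j \<bullet> x) {..<mE}"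
  have "?h x \<le> (\<Sum>j<mE. norm (A j)) * norm x" for x
  proof -
    have "?h x \<le> (\<Sum>j<mE. \<bar>A j \<bullet> x\<bar>)"
      by (rule L2_set_le_sum_abs)
    also have "\<dots> \<le> (\<Sum>j<mE. norm (A j) * norm x)"
      by (intro sum_mono Cauchy_Schwarz_ineq2)
    finally show ?thesis
      by (simp add: sum_distrib_right)
  qed
  then have "norm (?h x) / norm x \<le> (\<Sum>j<mE. norm (A j))" for x
    by (cases "x = 0") (simp_all add: L2_set_nonneg divide_le_eq sum_nonneg)
  then have "bdd_above (range (\<lambda>x. norm (?h x) / norm x))"
    by (auto intro!: bdd_aboveI)
  then have "norm (?h x) / norm x \<le> spectral_norm mE A"
    unfolding spectral_norm_def onorm_def by (intro cSUP_upper) auto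
  then show ?thesis
    using False by (simp add: L2_set_nonneg divide_le_eq)
qed (simp add: L2_set_def)

text \<open>
  The numerical core. The letters stand for norms at one state: \<open>X\<close> of the primal error, \<open>P\<close> of the pull
  of the multiplier errors on it, \<open>N\<close> of the gradient increment of \<open>f\<close>, \<open>R\<close> and \<open>Q\<close> of the two remainders
  of the primal velocity, while \<open>e / \<rho>\<close> is the energy dissipated by the constraints and \<open>S\<close> that of the
  objective; \<open>Y\<close> and \<open>Yi\<close> are the squared multiplier errors that are visible to the pull and those of the
  inactive constraints.

  The negative terms \<open>- S\<close>, \<open>- e / \<rho>\<close> and \<open>- \<epsilon> P\<^sup>2\<close> have to pay for everything else. The coefficient
  \<open>1\<close> of \<open>\<epsilon> P\<^sup>2\<close> is split into \<open>1/4\<close> for the product \<open>X P\<close>, \<open>7/20\<close> for \<open>N\<close> and \<open>Q\<close>, \<open>3/20\<close> for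
  \<open>R\<close> and \<open>1/4\<close> for \<open>\<beta> Y\<close>; the last share fixes \<open>\<epsilon> = 4 \<beta> / \<kappa>\<close>. The first condition on \<open>\<beta>\<close> keeps the
  charges to \<open>e / \<rho>\<close> below \<open>40/46 + 2/46 + 2/46\<close>. The second one covers the charges to \<open>X\<^sup>2\<close>;
  there, cocoercivity \<open>N\<^sup>2 \<le> l S\<close> is needed because bounding \<open>N\<close> by \<open>l X\<close> alone would
  cost \<open>l\<^sup>2\<close> where the condition provides only \<open>l \<mu>\<close>.
\<close>

section \<open>The dissipation budget\<close>

lemma dissipation_budget:
  fixes S e X P N Q R Y Yi :: real
  assumes pos: "\<rho> > 0" "\<kappa> > 0" "\<beta> > 0" "\<mu> > 0" "l \<ge> 0" "M \<ge> 0" and \<delta>: "0 < \<delta>" "\<delta> \<le> 1"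
    and \<kappa>: "\<kappa> \<le> L\<^sup>2 + a\<^sup>2"
    and c1: "\<beta> \<le> \<kappa> * \<delta> / (46 * \<rho> * (L\<^sup>2 + a\<^sup>2))"
    and c2: "\<kappa> * \<mu> / (4 * \<beta>) - 4 * \<beta>\<^sup>2
      \<ge> a\<^sup>2 + L\<^sup>2 + \<kappa> / 4 + (l + M) * (\<mu> + M + 1 / \<rho>) + 1 / (2 * \<rho>\<^sup>2)"
    and nonneg: "X \<ge> 0" "P \<ge> 0" "N \<ge> 0" "e \<ge> 0"
    and S: "\<mu> * X\<^sup>2 \<le> S" "N\<^sup>2 \<le> l * S" and N: "N \<le> l * X" and Q: "Q \<le> M * X"
    and R: "R\<^sup>2 \<le> L\<^sup>2 * (6 / \<delta>) * e"
    and Y: "\<kappa> * Y \<le> P\<^sup>2" and Yi: "Yi \<le> 2 / \<delta> * e"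
  defines "\<epsilon> \<equiv> 4 * \<beta> / \<kappa>"
  shows "- S - e / \<rho> + \<epsilon> * (a\<^sup>2 * X\<^sup>2 + X * L * sqrt e / \<rho> - P\<^sup>2 + P * N + P * R + P * Q)
    + \<beta> * (X\<^sup>2 + Y + Yi) + 2 * \<beta> * \<epsilon> * (X * P) \<le> 0"
proof -
  have \<epsilon>: "\<epsilon> > 0" "\<epsilon> * \<kappa> = 4 * \<beta>"
    using pos by (auto simp: \<epsilon>_def)
  define K where "K = L\<^sup>2 + a\<^sup>2"
  have K: "K > 0" "\<kappa> \<le> K" "L\<^sup>2 \<le> K"
    using \<kappa> pos by (auto simp: K_def)
  have small: "\<beta> * (46 * \<rho> * K) \<le> \<kappa> * \<delta>"
    using c1 K pos by (simp add: K_def[symmetric] le_divide_eq)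
  have \<epsilon>small: "\<epsilon> * \<rho> * K \<le> 4 / 46 * \<delta>"
    using small pos by (simp add: \<epsilon>_def field_simps)
  have \<epsilon>L: "\<epsilon> * L\<^sup>2 * e \<le> 4 / 46 * \<delta> * (e / \<rho>)"
  proof -
    have "\<epsilon> * L\<^sup>2 * e * \<rho> \<le> (\<epsilon> * \<rho> * K) * e"
      using mult_left_mono[OF K(3), of "\<epsilon> * e * \<rho>"] \<epsilon> pos nonneg by (simp add: algebra_simps)
    also have "\<dots> \<le> 4 / 46 * \<delta> * e"
      using \<epsilon>small nonneg by (intro mult_right_mono)
    finally show ?thesis
      using pos by (simp add: field_simps)
  qed
  have \<beta>Yi: "\<beta> * Yi \<le> 2 / 46 * (e / \<rho>)"
  proof -
    have "(\<beta> * (46 * \<rho>)) * K \<le> \<delta> * K"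
      using order_trans[OF small mult_right_mono[OF K(2), of \<delta>]] \<delta> by (simp add: algebra_simps)
    then have "\<beta> * (46 * \<rho>) \<le> \<delta>"
      using K(1) by simp
    then have "\<beta> / \<delta> \<le> 1 / (46 * \<rho>)"
      using \<delta> pos by (simp add: field_simps)
    then have "2 * e * (\<beta> / \<delta>) \<le> 2 * e * (1 / (46 * \<rho>))"
      using nonneg by (intro mult_left_mono) auto
    moreover have "\<beta> * Yi \<le> \<beta> * (2 / \<delta> * e)"
      using Yi pos by (intro mult_left_mono) auto
    ultimately show ?thesis
      by (simp add: algebra_simps)
  qed
  have \<beta>Y: "\<beta> * Y \<le> \<epsilon> * P\<^sup>2 / 4"
    using mult_left_mono[OF Y, of "\<epsilon> / 4"] \<epsilon> by (simp add: mult.assoc[symmetric])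
  have \<epsilon>R: "\<epsilon> * R\<^sup>2 / (6 / 10) \<le> 40 / 46 * (e / \<rho>)"
  proof -
    have "\<epsilon> * R\<^sup>2 \<le> \<epsilon> * (L\<^sup>2 * (6 / \<delta>) * e)"
      using R \<epsilon> by (intro mult_left_mono) auto
    also have "\<dots> = 6 / \<delta> * (\<epsilon> * L\<^sup>2 * e)"
      by simp
    also have "\<dots> \<le> 6 / \<delta> * (4 / 46 * \<delta> * (e / \<rho>))"
      using \<epsilon>L \<delta> by (intro mult_left_mono) auto
    also have "\<dots> = 24 / 46 * (e / \<rho>)"
      using \<delta> by simp
    finally show ?thesis
      by simp
  qed
  have \<epsilon>L': "\<epsilon> * L\<^sup>2 * e \<le> 4 / 46 * (e / \<rho>)"
    using \<epsilon>L mult_right_mono[OF \<delta>(2), of "e / \<rho>"] nonneg pos by simp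
  have t1: "2 * \<beta> * (X * P) \<le> 4 * \<beta>\<^sup>2 * X\<^sup>2 + P\<^sup>2 / 4"
    using zero_le_power2[of "2 * \<beta> * X - P / 2"] by (simp add: power2_eq_square algebra_simps)
  have t2: "P * N + P * Q \<le> 35 / 100 * P\<^sup>2 + l * S + M\<^sup>2 * X\<^sup>2 + l * M * X\<^sup>2"
  proof -
    define T where "T = N + M * X"
    have "P * N + P * Q \<le> P * T"
      using mult_left_mono[OF Q nonneg(2)] by (simp add: T_def algebra_simps)
    also have "\<dots> \<le> 35 / 100 * P\<^sup>2 + T\<^sup>2 / (14 / 10)"
      using zero_le_power2[of "7 * P - 10 * T"] by (simp add: power2_eq_square algebra_simps)
    also have "T\<^sup>2 \<le> 14 / 10 * N\<^sup>2 + 14 / 10 * (M * X)\<^sup>2 + 12 / 10 * (N * (M * X))"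
      using zero_le_power2[of "N - M * X"] by (simp add: T_def power2_eq_square algebra_simps)
    also have "N * (M * X) \<le> (l * X) * (M * X)"
      using N pos nonneg by (intro mult_right_mono) auto
    also have "N\<^sup>2 \<le> l * S"
      by (rule S)
    finally have "P * N + P * Q \<le> 35 / 100 * P\<^sup>2 + (14 / 10 * (l * S) + 14 / 10 * (M * X)\<^sup>2 + 12 / 10 * ((l * X) * (M * X))) / (14 / 10)"
      by simp
    moreover have "0 \<le> (l * X) * (M * X)"
      using pos nonneg by simp
    ultimately show ?thesis
      by (simp add: power2_eq_square algebra_simps add_divide_distrib)
  qed
  have t3: "P * R \<le> 15 / 100 * P\<^sup>2 + R\<^sup>2 / (6 / 10)"
    using zero_le_power2[of "3 * P - 10 * R"] by (simp add: power2_eq_square algebra_simps)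
  have t4: "X * L * sqrt e / \<rho> \<le> 1 / (2 * \<rho>\<^sup>2) * X\<^sup>2 + L\<^sup>2 * e / 2"
  proof -
    have "0 \<le> (X / \<rho> - L * sqrt e)\<^sup>2"
      by simp
    also have "\<dots> = X\<^sup>2 / \<rho>\<^sup>2 + L\<^sup>2 * e - 2 * (X * L * sqrt e / \<rho>)"
      using nonneg by (simp add: power2_diff power_mult_distrib power_divide)
    finally show ?thesis
      by simp
  qed
  have \<mu>: "\<epsilon> * (a\<^sup>2 + L\<^sup>2 + \<kappa> / 4 + (l + M) * (\<mu> + M + 1 / \<rho>) + 1 / (2 * \<rho>\<^sup>2) + 4 * \<beta>\<^sup>2) \<le> \<mu>"
  proof -
    have "\<kappa> * \<mu> / (4 * \<beta>) = \<mu> / \<epsilon>"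
      by (simp add: \<epsilon>_def)
    then have "a\<^sup>2 + L\<^sup>2 + \<kappa> / 4 + (l + M) * (\<mu> + M + 1 / \<rho>) + 1 / (2 * \<rho>\<^sup>2) + 4 * \<beta>\<^sup>2 \<le> \<mu> / \<epsilon>"
      using c2 by linarith
    then show ?thesis
      unfolding pos_le_divide_eq[OF \<epsilon>(1)] by (simp only: mult.commute)
  qed
  define B where "B = a\<^sup>2 + \<kappa> / 4 + l * \<mu> + l * M + M\<^sup>2 + 1 / (2 * \<rho>\<^sup>2) + 4 * \<beta>\<^sup>2"
  have "B \<le> a\<^sup>2 + L\<^sup>2 + \<kappa> / 4 + (l + M) * (\<mu> + M + 1 / \<rho>) + 1 / (2 * \<rho>\<^sup>2) + 4 * \<beta>\<^sup>2"
  proof -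
    have "0 \<le> M * \<mu>" "0 \<le> (l + M) * (1 / \<rho>)"
      using pos by auto
    moreover have "(l + M) * (\<mu> + M + 1 / \<rho>) = l * \<mu> + l * M + M\<^sup>2 + M * \<mu> + (l + M) * (1 / \<rho>)"
      by (simp add: distrib_left distrib_right power2_eq_square)
    ultimately show ?thesis
      using zero_le_power2[of L] unfolding B_def by linarith
  qed
  from order_trans[OF mult_left_mono[OF this less_imp_le[OF \<epsilon>(1)]] \<mu>]
  have \<mu>B: "\<epsilon> * B \<le> \<mu>" .
  have "\<epsilon> * (l * \<mu>) \<le> \<epsilon> * B"
    using pos \<epsilon> by (intro mult_left_mono) (auto simp: B_def)
  then have "(\<epsilon> * l) * \<mu> \<le> 1 * \<mu>"
    using \<mu>B by (simp add: mult.assoc)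
  then have "\<epsilon> * l \<le> 1"
    using pos(4) by (rule mult_right_le_imp_le)
  then have "(1 - \<epsilon> * l) * (\<mu> * X\<^sup>2) \<le> (1 - \<epsilon> * l) * S"
    using S by (intro mult_left_mono) auto
  then have SX: "- S + \<epsilon> * (l * S) \<le> \<epsilon> * (l * \<mu>) * X\<^sup>2 - \<mu> * X\<^sup>2"
    by (simp add: algebra_simps)
  have \<mu>BX: "\<epsilon> * B * X\<^sup>2 \<le> \<mu> * X\<^sup>2"
    using \<mu>B by (intro mult_right_mono) auto
  have "a\<^sup>2 * X\<^sup>2 + X * L * sqrt e / \<rho> - P\<^sup>2 + P * N + P * R + P * Q + 2 * \<beta> * (X * P)
    \<le> (a\<^sup>2 + 1 / (2 * \<rho>\<^sup>2) + M\<^sup>2 + l * M + 4 * \<beta>\<^sup>2) * X\<^sup>2 + L\<^sup>2 * e / 2 - P\<^sup>2 / 4 + l * S + R\<^sup>2 / (6 / 10)"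
    using t1 t2 t3 t4 by (simp add: algebra_simps)
  from mult_left_mono[OF this, of \<epsilon>] \<epsilon>(1)
  have "\<epsilon> * (a\<^sup>2 * X\<^sup>2 + X * L * sqrt e / \<rho> - P\<^sup>2 + P * N + P * R + P * Q) + 2 * \<beta> * \<epsilon> * (X * P)
    \<le> \<epsilon> * (a\<^sup>2 + 1 / (2 * \<rho>\<^sup>2) + M\<^sup>2 + l * M + 4 * \<beta>\<^sup>2) * X\<^sup>2 + \<epsilon> * L\<^sup>2 * e / 2 - \<epsilon> * P\<^sup>2 / 4 + \<epsilon> * (l * S) + \<epsilon> * R\<^sup>2 / (6 / 10)"
    by (simp add: algebra_simps)
  moreover have "\<epsilon> * B * X\<^sup>2 = \<epsilon> * (a\<^sup>2 + 1 / (2 * \<rho>\<^sup>2) + M\<^sup>2 + l * M + 4 * \<beta>\<^sup>2) * X\<^sup>2 + \<beta> * X\<^sup>2 + \<epsilon> * (l * \<mu>) * X\<^sup>2"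
    using \<epsilon>(2) by (simp add: B_def algebra_simps)
  moreover have "\<beta> * (X\<^sup>2 + Y + Yi) = \<beta> * X\<^sup>2 + \<beta> * Y + \<beta> * Yi"
    by (simp add: algebra_simps)
  moreover have "0 \<le> e / \<rho>"
    using nonneg pos by simp
  ultimately show ?thesis
    using SX \<mu>BX \<epsilon>R \<epsilon>L' \<beta>Y \<beta>Yi by linarith
qed

section \<open>Estimates at a single state\<close>

text \<open>
  A fixed problem with constants valid on the ball of radius \<open>d\<close> about the optimum; \<open>d\<close> will be the
  initial distance of a trajectory.
\<close>

locale augmented_dynamics =
  fixes f :: "real^'n \<Rightarrow> real" and df :: "real^'n \<Rightarrow> real^'n"
    and mI :: nat and g :: "nat \<Rightarrow> real^'n \<Rightarrow> real" and dg :: "nat \<Rightarrow> real^'n \<Rightarrow> real^'n"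
    and mE :: nat and A :: "nat \<Rightarrow> real^'n" and b :: "nat \<Rightarrow> real"
    and xs :: "real^'n" and ls ns :: "nat \<Rightarrow> real"
    and \<mu> l \<rho> :: real and Lg Mg :: "nat \<Rightarrow> real \<Rightarrow> real" and d :: real
  assumes f_grad: "\<And>x. GDERIV f x :> df x" and f_convex: "convex_on UNIV f"
    and g_grad: "\<And>i x. i < mI \<Longrightarrow> GDERIV (g i) x :> dg i x"
    and g_convex: "\<And>i. i < mI \<Longrightarrow> convex_on UNIV (g i)"
    and licq: "LICQ mI g dg mE A xs"
    and kkt: "KKT df mI g dg mE A b xs ls ns"
    and \<mu>_pos: "\<mu> > 0" and f_strongly_convex: "strongly_convex \<mu> f"
    and smooth: "smoothness_constants df mI dg xs l Lg Mg"
    and \<rho>_pos: "\<rho> > 0" and d_nonneg: "d \<ge> 0"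
begin

definition act :: "nat set" where "act = {i. i < mI \<and> g i xs = 0}"
definition \<kappa> :: real where "\<kappa> = kappa mI g dg mE A xs"
definition \<delta> :: real where "\<delta> = delta_min \<rho> mI g xs d"
definition L :: real where "L = sqrt (\<Sum>i<mI. (Lg i d)\<^sup>2)"
definition M\<Theta> :: real where
  "M\<Theta> = M_Theta \<rho> L (sqrt (\<Sum>i<mI. (Mg i d)\<^sup>2)) d (L2_set ls {..<mI})"
definition a :: real where "a = spectral_norm mE A"

definition u :: "real^'n \<Rightarrow> (nat \<Rightarrow> real) \<Rightarrow> nat \<Rightarrow> real" where
  "u x lam i = max (\<rho> * g i x + lam i) 0"
definition xdot :: "real^'n \<Rightarrow> (nat \<Rightarrow> real) \<Rightarrow> (nat \<Rightarrow> real) \<Rightarrow> real^'n" where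
  "xdot x lam nu = - df x - (\<Sum>j<mE. nu j *\<^sub>R A j) - (\<Sum>i<mI. u x lam i *\<^sub>R dg i x)"
definition ldot :: "real^'n \<Rightarrow> (nat \<Rightarrow> real) \<Rightarrow> nat \<Rightarrow> real" where
  "ldot x lam i = (u x lam i - lam i) / \<rho>"
definition ndot :: "real^'n \<Rightarrow> nat \<Rightarrow> real" where
  "ndot x j = A j \<bullet> x - b j"

text \<open>
  Up to the factor \<open>\<rho>\<close>, this is the energy dissipated through the constraint \<open>i\<close>: what is left of its share
  in the derivative of \<open>\<parallel>z - z\<^sup>*\<parallel>\<^sup>2 / 2\<close> once the gradients of \<open>g\<^sub>i\<close> are replaced by increments of \<open>g\<^sub>i\<close>.
\<close>

definition diss :: "real^'n \<Rightarrow> (nat \<Rightarrow> real) \<Rightarrow> nat \<Rightarrow> real" where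
  "diss x lam i = (u x lam i - ls i) * (\<rho> * (g i x - g i xs) + (lam i - ls i))
     - 2 * (lam i - ls i) * (u x lam i - ls i) + (lam i - ls i)\<^sup>2"

text \<open>
  The force \<open>J\<^sub>I\<^sup>T y + A\<^sup>T v\<close> that multiplier errors exert on the primal variable, linearized at the
  optimum. Through \<open>\<kappa>\<close> its norm controls these errors, which need not show up in the dissipation.
\<close>

definition pull :: "(nat \<Rightarrow> real) \<Rightarrow> (nat \<Rightarrow> real) \<Rightarrow> real^'n" where
  "pull y v = (\<Sum>i\<in>act. y i *\<^sub>R dg i xs) + (\<Sum>j<mE. v j *\<^sub>R A j)"

lemma g_tangent:
  assumes "i < mI"
  shows "(x - xs) \<bullet> dg i xs \<le> g i x - g i xs" and "g i x - g i xs \<le> (x - xs) \<bullet> dg i x"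
  using strongly_convex_above_tangent[OF convex_imp_strongly_convex_0[OF g_convex] g_grad, OF assms assms, of xs x]
    strongly_convex_above_tangent[OF convex_imp_strongly_convex_0[OF g_convex] g_grad, OF assms assms, of x xs]
  by (simp_all add: inner_diff_left)

lemma stationary: "df xs + (\<Sum>i<mI. ls i *\<^sub>R dg i xs) + (\<Sum>j<mE. ns j *\<^sub>R A j) = 0"
  and feasible_xs: "i < mI \<Longrightarrow> g i xs \<le> 0" "j < mE \<Longrightarrow> A j \<bullet> xs = b j"
  and ls_nonneg: "i < mI \<Longrightarrow> 0 \<le> ls i"
  and complementary: "i < mI \<Longrightarrow> g i xs \<noteq> 0 \<Longrightarrow> ls i = 0"
  using kkt by (auto simp: KKT_def feasible_def)

text \<open>
  Complementary slackness: at the optimum the multiplier step is at rest, so \<open>u - \<lambda>\<^sup>*\<close> is an increment of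
  the positive part.
\<close>

lemma ls_fixed_point: "i < mI \<Longrightarrow> max (\<rho> * g i xs + ls i) 0 = ls i"
  using ls_nonneg[of i] complementary[of i] feasible_xs(1)[of i] \<rho>_pos
  by (cases "g i xs = 0") (auto simp: max_def mult_nonneg_nonpos mult_le_0_iff)

lemma u_increment_sq_le:
  assumes "i < mI"
  shows "(u x lam i - ls i)\<^sup>2 \<le> (u x lam i - ls i) * (\<rho> * (g i x - g i xs) + (lam i - ls i))"
  using projection_step_sq_le[of "\<rho> * (g i x - g i xs) + (lam i - ls i)" "\<rho> * g i xs + ls i"] ls_fixed_point[OF assms]
  by (simp add: u_def algebra_simps)

lemma diss_ge_sq:
  assumes "i < mI"
  shows "(u x lam i - lam i)\<^sup>2 \<le> diss x lam i"
  using u_increment_sq_le[OF assms, of x lam] by (simp add: diss_def power2_eq_square algebra_simps)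

lemma diss_nonneg: "i < mI \<Longrightarrow> 0 \<le> diss x lam i"
  using diss_ge_sq[of i x lam] zero_le_power2 order_trans by blast

lemma \<delta>_le_1: "\<delta> \<le> 1"
  unfolding \<delta>_def delta_min_def Let_def by auto

lemma \<delta>_le:
  assumes "i < mI" "g i xs \<noteq> 0" "d > 0"
  shows "\<delta> \<le> 1 - (max (1 - (- \<rho> * g i xs) / d) 0)\<^sup>2"
proof -
  let ?G = "(\<lambda>i. g i xs) ` {i. i < mI \<and> g i xs \<noteq> 0}"
  have "g i xs \<le> Max ?G"
    using assms by (intro Max_ge) auto
  then have "\<rho> * g i xs / d \<le> \<rho> * Max ?G / d"
    using \<rho>_pos assms(3) by (intro divide_right_mono mult_left_mono) auto
  then have "(max (1 - (- \<rho> * g i xs) / d) 0)\<^sup>2 \<le> (max (1 + \<rho> * Max ?G / d) 0)\<^sup>2"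
    by (intro power_mono) auto
  then show ?thesis
    using assms by (auto simp: \<delta>_def delta_min_def Let_def)
qed

lemma \<delta>_pos: "\<delta> > 0"
proof (cases "{i. i < mI \<and> g i xs \<noteq> 0} = {} \<or> d = 0")
  case False
  let ?G = "(\<lambda>i. g i xs) ` {i. i < mI \<and> g i xs \<noteq> 0}"
  have d: "d > 0"
    using False d_nonneg by auto
  have "Max ?G \<in> ?G"
    using False by (intro Max_in) auto
  then obtain i where "i < mI" "g i xs \<noteq> 0" "Max ?G = g i xs"
    by auto
  then have "Max ?G < 0"
    using feasible_xs(1)[of i] by simp
  then have "\<rho> * Max ?G / d < 0"
    using \<rho>_pos d by (simp add: divide_neg_pos mult_pos_neg)
  then have "(max (1 + \<rho> * Max ?G / d) 0)\<^sup>2 < 1\<^sup>2"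
    by (intro power_strict_mono) auto
  then show ?thesis
    using False by (simp add: \<delta>_def delta_min_def Let_def)
qed (auto simp: \<delta>_def delta_min_def)

text \<open>
  The dissipation of an inactive constraint controls its multiplier and its force, at the price of a factor
  \<open>1 / \<delta>\<close>.
\<close>

lemma inactive_diss:
  assumes i: "i < mI" "g i xs \<noteq> 0" and lam: "0 \<le> lam i" "lam i \<le> d"
  shows "(lam i)\<^sup>2 \<le> 2 / \<delta> * diss x lam i" and "(u x lam i)\<^sup>2 \<le> 6 / \<delta> * diss x lam i"
proof -
  have ls: "ls i = 0"
    using complementary i by blast
  have neg: "g i xs < 0"
    using feasible_xs(1)[OF i(1)] i(2) by simp
  have "\<delta> / 2 * (lam i)\<^sup>2 \<le> diss x lam i"
  proof (cases "d = 0")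
    case True
    then show ?thesis
      using lam diss_nonneg[OF i(1), of x lam] by simp
  next
    case False
    then have d: "d > 0"
      using d_nonneg by simp
    define s where "s = \<rho> * (g i x - g i xs) + lam i"
    have eta: "0 < - \<rho> * g i xs"
      using neg \<rho>_pos by (simp add: mult_pos_neg)
    have ui: "u x lam i = max (s - (- \<rho> * g i xs)) 0"
      by (simp add: u_def s_def algebra_simps)
    have "\<delta> / 2 * (lam i)\<^sup>2 \<le> (1 - (max (1 - (- \<rho> * g i xs) / d) 0)\<^sup>2) / 2 * (lam i)\<^sup>2"
      using \<delta>_le[OF i d] by (intro mult_right_mono) auto
    also have "\<dots> \<le> diss x lam i"
      using inactive_damping[OF eta lam d, of s] unfolding diss_def ls ui by (simp add: s_def)
    finally show ?thesis .
  qed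
  then show lam2: "(lam i)\<^sup>2 \<le> 2 / \<delta> * diss x lam i"
    using \<delta>_pos by (simp add: field_simps)
  have "0 \<le> (u x lam i - lam i - lam i)\<^sup>2"
    by simp
  then have "(u x lam i)\<^sup>2 \<le> 2 * (u x lam i - lam i)\<^sup>2 + 2 * (lam i)\<^sup>2"
    by (simp add: power2_eq_square algebra_simps)
  also have "\<dots> \<le> 2 * diss x lam i + 2 * (2 / \<delta> * diss x lam i)"
    using lam2 diss_ge_sq[OF i(1), of x lam] by simp
  also have "\<dots> \<le> 2 / \<delta> * diss x lam i + 2 * (2 / \<delta> * diss x lam i)"
    using \<delta>_pos \<delta>_le_1 diss_nonneg[OF i(1), of x lam] by (intro add_mono mult_right_mono) (auto simp: le_divide_eq)
  finally show "(u x lam i)\<^sup>2 \<le> 6 / \<delta> * diss x lam i"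
    by simp
qed

text \<open>
  Half the squared distance to the optimum decreases. Convexity of \<open>g\<^sub>i\<close>, used at both endpoints, replaces the
  gradients by increments of \<open>g\<^sub>i\<close>; the terms coupling \<open>x\<close> and \<open>\<nu>\<close> cancel, and what remains for each
  constraint is exactly its dissipation.
\<close>

lemma energy_dissipation:
  "(x - xs) \<bullet> xdot x lam nu + (\<Sum>i<mI. (lam i - ls i) * ldot x lam i) + (\<Sum>j<mE. (nu j - ns j) * ndot x j)
    \<le> - ((x - xs) \<bullet> (df x - df xs)) - (\<Sum>i<mI. diss x lam i) / \<rho>"
proof -
  let ?X = "x - xs"
  have "xdot x lam nu = xdot x lam nu + (df xs + (\<Sum>i<mI. ls i *\<^sub>R dg i xs) + (\<Sum>j<mE. ns j *\<^sub>R A j))"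
    by (simp add: stationary)
  also have "\<dots> = - (df x - df xs) - (\<Sum>j<mE. (nu j - ns j) *\<^sub>R A j)
      - (\<Sum>i<mI. u x lam i *\<^sub>R dg i x - ls i *\<^sub>R dg i xs)"
    by (simp add: xdot_def sum_subtractf scaleR_diff_left algebra_simps)
  finally have "?X \<bullet> xdot x lam nu = - (?X \<bullet> (df x - df xs)) - (\<Sum>j<mE. (nu j - ns j) * (?X \<bullet> A j))
      - (\<Sum>i<mI. u x lam i * (?X \<bullet> dg i x) - ls i * (?X \<bullet> dg i xs))"
    by (simp add: inner_diff_right inner_sum_right inner_minus_right)
  moreover have "(\<Sum>j<mE. (nu j - ns j) * ndot x j) = (\<Sum>j<mE. (nu j - ns j) * (?X \<bullet> A j))"
    by (intro sum.cong) (auto simp: ndot_def feasible_xs(2)[symmetric] inner_commute[of "x - xs"] inner_diff_right)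
  moreover have "(\<Sum>i<mI. (lam i - ls i) * ldot x lam i) - (\<Sum>i<mI. u x lam i * (?X \<bullet> dg i x) - ls i * (?X \<bullet> dg i xs))
      \<le> - (\<Sum>i<mI. diss x lam i) / \<rho>"
  proof -
    have "(lam i - ls i) * ldot x lam i - (u x lam i * (?X \<bullet> dg i x) - ls i * (?X \<bullet> dg i xs)) \<le> - (diss x lam i / \<rho>)"
      if i: "i < mI" for i
    proof -
      have "u x lam i * (g i x - g i xs) \<le> u x lam i * (?X \<bullet> dg i x)"
        using g_tangent[OF i] by (intro mult_left_mono) (auto simp: u_def)
      moreover have "ls i * (?X \<bullet> dg i xs) \<le> ls i * (g i x - g i xs)"
        using g_tangent[OF i] ls_nonneg[OF i] by (intro mult_left_mono) auto
      moreover have "(lam i - ls i) * ldot x lam i - (u x lam i - ls i) * (g i x - g i xs) = - (diss x lam i / \<rho>)"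
        using \<rho>_pos by (simp add: ldot_def diss_def power2_eq_square field_simps)
      ultimately show ?thesis
        by (simp add: algebra_simps)
    qed
    then have "(\<Sum>i<mI. (lam i - ls i) * ldot x lam i - (u x lam i * (?X \<bullet> dg i x) - ls i * (?X \<bullet> dg i xs)))
        \<le> (\<Sum>i<mI. - (diss x lam i / \<rho>))"
      by (intro sum_mono) auto
    then show ?thesis
      by (simp add: sum_subtractf sum_negf sum_divide_distrib)
  qed
  ultimately show ?thesis
    by linarith
qed

lemma f_monotone: "\<mu> * (norm (x - xs))\<^sup>2 \<le> (x - xs) \<bullet> (df x - df xs)"
  by (rule strongly_convex_gradient_monotone[OF f_strongly_convex f_grad f_grad])

lemma df_lipschitz: "norm (df x - df y) \<le> l * norm (x - y)"
  using smooth lipschitz_onD[of l UNIV df x y] by (auto simp: smoothness_constants_def dist_norm)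

lemma \<mu>_le_l: "\<mu> \<le> l"
proof -
  define h :: "real^'n" where "h = axis undefined 1"
  have "\<mu> * (norm ((xs + h) - xs))\<^sup>2 \<le> norm ((xs + h) - xs) * norm (df (xs + h) - df xs)"
    using f_monotone[of "xs + h"] norm_cauchy_schwarz order_trans by blast
  then show ?thesis
    using df_lipschitz[of "xs + h" xs] by (simp add: h_def norm_axis_1)
qed

lemma df_cocoercive: "(norm (df x - df xs))\<^sup>2 \<le> l * ((x - xs) \<bullet> (df x - df xs))"
  using gradient_cocoercive[OF f_convex f_grad, of l x xs] smooth \<mu>_le_l \<mu>_pos
  by (auto simp: smoothness_constants_def)

lemma Lg_nonneg: "i < mI \<Longrightarrow> 0 \<le> Lg i d" and Mg_nonneg: "i < mI \<Longrightarrow> 0 \<le> Mg i d"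
  and dg_bound: "i < mI \<Longrightarrow> norm (x - xs) \<le> d \<Longrightarrow> norm (dg i x) \<le> Lg i d"
  using smooth d_nonneg by (auto simp: smoothness_constants_def)

lemma dg_lipschitz: "i < mI \<Longrightarrow> norm (x - xs) \<le> d \<Longrightarrow> norm (dg i x - dg i xs) \<le> Mg i d * norm (x - xs)"
  using smooth d_nonneg lipschitz_onD[of "Mg i d" "{x. norm (x - xs) \<le> d}" "dg i" x xs]
  by (auto simp: smoothness_constants_def dist_norm)

lemma L_eq: "L = L2_set (\<lambda>i. Lg i d) {..<mI}"
  by (simp add: L_def L2_set_def)

lemma L_nonneg: "L \<ge> 0"
  by (simp add: L_eq)

lemma L2_increments:
  assumes "\<And>i. i < mI \<Longrightarrow> (r i)\<^sup>2 \<le> c * diss x lam i" and "c \<ge> 0"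
  shows "(\<Sum>i<mI. Lg i d * \<bar>r i\<bar>) \<le> L * sqrt (c * (\<Sum>i<mI. diss x lam i))"
proof -
  have "(\<Sum>i<mI. Lg i d * \<bar>r i\<bar>) = (\<Sum>i<mI. \<bar>Lg i d\<bar> * \<bar>r i\<bar>)"
    using Lg_nonneg by (intro sum.cong) auto
  also have "\<dots> \<le> L * L2_set r {..<mI}"
    unfolding L_eq by (rule L2_set_mult_ineq)
  also have "L2_set r {..<mI} \<le> sqrt (c * (\<Sum>i<mI. diss x lam i))"
    unfolding L2_set_def sum_distrib_left using assms by (intro real_sqrt_le_mono sum_mono) auto
  finally show ?thesis
    using L_nonneg by (simp add: mult_left_mono)
qed

text \<open>
  Remainders of the primal velocity: the first comes from multipliers that are not at rest or belong to
  inactive constraints and is paid for by the dissipation of the constraints, the second from the curvature of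
  the active constraints and is of the order of the primal error.
\<close>

definition coupling_error :: "real^'n \<Rightarrow> (nat \<Rightarrow> real) \<Rightarrow> real^'n" where
  "coupling_error x lam = (\<Sum>i<mI. if g i xs = 0 then (u x lam i - lam i) *\<^sub>R dg i xs else u x lam i *\<^sub>R dg i x)"
definition curvature_error :: "real^'n \<Rightarrow> (nat \<Rightarrow> real) \<Rightarrow> real^'n" where
  "curvature_error x lam = (\<Sum>i<mI. if g i xs = 0 then u x lam i *\<^sub>R (dg i x - dg i xs) else 0)"

lemma sum_act: "(\<Sum>i\<in>act. h i) = (\<Sum>i<mI. if g i xs = 0 then h i else 0)"
  for h :: "nat \<Rightarrow> 'c :: comm_monoid_add"
  unfolding act_def by (subst sum.inter_filter[symmetric]) auto

text \<open>
  Subtracting the stationarity condition from the velocity isolates the pull of the multiplier errors. The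
  pairing of the velocity with the pull is therefore \<open>- \<parallel>pull\<parallel>\<^sup>2\<close> plus controllable terms.
\<close>

lemma xdot_decomposition:
  "xdot x lam nu = - pull (\<lambda>i. lam i - ls i) (\<lambda>j. nu j - ns j) - (df x - df xs)
    - coupling_error x lam - curvature_error x lam"
proof -
  have "xdot x lam nu = xdot x lam nu + (df xs + (\<Sum>i<mI. ls i *\<^sub>R dg i xs) + (\<Sum>j<mE. ns j *\<^sub>R A j))"
    by (simp add: stationary)
  also have "\<dots> = - (df x - df xs) - (\<Sum>j<mE. (nu j - ns j) *\<^sub>R A j)
      - (\<Sum>i<mI. u x lam i *\<^sub>R dg i x - ls i *\<^sub>R dg i xs)"
    by (simp add: xdot_def sum_subtractf scaleR_diff_left algebra_simps)
  also have "(\<Sum>i<mI. u x lam i *\<^sub>R dg i x - ls i *\<^sub>R dg i xs)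
      = (\<Sum>i<mI. (if g i xs = 0 then (lam i - ls i) *\<^sub>R dg i xs else 0)
          + (if g i xs = 0 then (u x lam i - lam i) *\<^sub>R dg i xs else u x lam i *\<^sub>R dg i x)
          + (if g i xs = 0 then u x lam i *\<^sub>R (dg i x - dg i xs) else 0))"
    using complementary by (intro sum.cong) (auto simp: algebra_simps)
  also have "\<dots> = (\<Sum>i\<in>act. (lam i - ls i) *\<^sub>R dg i xs) + coupling_error x lam + curvature_error x lam"
    by (simp add: sum.distrib sum_act coupling_error_def curvature_error_def)
  finally show ?thesis
    by (simp add: pull_def)
qed

lemma coupling_error_bound:
  assumes "norm (x - xs) \<le> d" and "\<And>i. i < mI \<Longrightarrow> 0 \<le> lam i" and "\<And>i. i < mI \<Longrightarrow> lam i - ls i \<le> d"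
  shows "(norm (coupling_error x lam))\<^sup>2 \<le> L\<^sup>2 * (6 / \<delta>) * (\<Sum>i<mI. diss x lam i)"
proof -
  define r where "r i = (if g i xs = 0 then u x lam i - lam i else u x lam i)" for i
  have "(r i)\<^sup>2 \<le> 6 / \<delta> * diss x lam i" if i: "i < mI" for i
  proof (cases "g i xs = 0")
    case True
    have "diss x lam i \<le> 6 / \<delta> * diss x lam i"
      using \<delta>_pos \<delta>_le_1 diss_nonneg[OF i, of x lam] mult_right_mono[of 1 "6 / \<delta>" "diss x lam i"] by simp
    then show ?thesis
      using diss_ge_sq[OF i, of x lam] True by (simp add: r_def)
  next
    case False
    then show ?thesis
      using inactive_diss(2)[OF i, of lam x] complementary[OF i] assms(2,3)[OF i] by (simp add: r_def)
  qed
  then have "(\<Sum>i<mI. Lg i d * \<bar>r i\<bar>) \<le> L * sqrt (6 / \<delta> * (\<Sum>i<mI. diss x lam i))"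
    using \<delta>_pos by (intro L2_increments) auto
  moreover have "norm (coupling_error x lam) \<le> (\<Sum>i<mI. Lg i d * \<bar>r i\<bar>)"
    unfolding coupling_error_def
  proof (rule order_trans[OF norm_sum], rule sum_mono)
    fix i assume "i \<in> {..<mI}"
    then have "norm (dg i x) * \<bar>r i\<bar> \<le> Lg i d * \<bar>r i\<bar>" "norm (dg i xs) * \<bar>r i\<bar> \<le> Lg i d * \<bar>r i\<bar>"
      using dg_bound[of i x] dg_bound[of i xs] assms(1) d_nonneg by (auto intro!: mult_right_mono)
    then show "norm (if g i xs = 0 then (u x lam i - lam i) *\<^sub>R dg i xs else u x lam i *\<^sub>R dg i x) \<le> Lg i d * \<bar>r i\<bar>"
      by (auto simp: r_def mult.commute)
  qed
  ultimately have "(norm (coupling_error x lam))\<^sup>2 \<le> (L * sqrt (6 / \<delta> * (\<Sum>i<mI. diss x lam i)))\<^sup>2"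
    by (intro power_mono) auto
  also have "\<dots> = L\<^sup>2 * (6 / \<delta>) * (\<Sum>i<mI. diss x lam i)"
  proof -
    have "0 \<le> 6 / \<delta> * (\<Sum>i<mI. diss x lam i)"
      using \<delta>_pos diss_nonneg by (intro mult_nonneg_nonneg sum_nonneg) auto
    then show ?thesis
      by (simp only: power_mult_distrib real_sqrt_pow2 mult.assoc)
  qed
  finally show ?thesis .
qed

lemma g_increment_bound:
  assumes "i < mI" "norm (x - xs) \<le> d"
  shows "\<bar>g i x - g i xs\<bar> \<le> Lg i d * norm (x - xs)"
proof -
  have "\<bar>(x - xs) \<bullet> dg i y\<bar> \<le> Lg i d * norm (x - xs)" if "norm (y - xs) \<le> d" for y
    using Cauchy_Schwarz_ineq2[of "x - xs" "dg i y"] mult_right_mono[OF dg_bound[OF assms(1) that], of "norm (x - xs)"]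
    by (simp add: mult.commute)
  from this[of x] this[of xs] show ?thesis
    using g_tangent[OF assms(1), of x] assms(2) d_nonneg by auto
qed

lemma u_L2_bound:
  assumes x: "norm (x - xs) \<le> d" and lam: "L2_set (\<lambda>i. lam i - ls i) {..<mI} \<le> d"
  shows "L2_set (u x lam) {..<mI} \<le> \<rho> * L * d + d + L2_set ls {..<mI}"
proof -
  have "u x lam i \<le> \<rho> * norm (x - xs) * Lg i d + \<bar>lam i - ls i\<bar> + ls i" if i: "i < mI" for i
  proof -
    define w s where "w = u x lam i - ls i" and "s = \<rho> * (g i x - g i xs) + (lam i - ls i)"
    have "\<bar>w\<bar> * \<bar>w\<bar> \<le> \<bar>w\<bar> * \<bar>s\<bar>"
      using u_increment_sq_le[OF i, of x lam] abs_ge_self[of "w * s"]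
      by (simp add: w_def s_def power2_eq_square abs_mult)
    then have "\<bar>w\<bar> \<le> \<bar>s\<bar>"
      using mult_left_le_imp_le[of "\<bar>w\<bar>" "\<bar>w\<bar>" "\<bar>s\<bar>"] by (cases "w = 0") auto
    also have "\<dots> \<le> \<rho> * \<bar>g i x - g i xs\<bar> + \<bar>lam i - ls i\<bar>"
      unfolding s_def using \<rho>_pos abs_triangle_ineq[of "\<rho> * (g i x - g i xs)" "lam i - ls i"] by (simp add: abs_mult)
    also have "\<rho> * \<bar>g i x - g i xs\<bar> \<le> \<rho> * (Lg i d * norm (x - xs))"
      using g_increment_bound[OF i x] \<rho>_pos by (intro mult_left_mono) auto
    finally show ?thesis
      by (simp add: w_def algebra_simps)
  qed
  then have "L2_set (u x lam) {..<mI} \<le> L2_set (\<lambda>i. \<rho> * norm (x - xs) * Lg i d + \<bar>lam i - ls i\<bar> + ls i) {..<mI}"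
    by (intro L2_set_mono) (auto simp: u_def)
  also have "\<dots> \<le> L2_set (\<lambda>i. \<rho> * norm (x - xs) * Lg i d) {..<mI} + L2_set (\<lambda>i. \<bar>lam i - ls i\<bar>) {..<mI} + L2_set ls {..<mI}"
    using L2_set_triangle_ineq[of "\<lambda>i. \<rho> * norm (x - xs) * Lg i d + \<bar>lam i - ls i\<bar>" ls "{..<mI}"]
      L2_set_triangle_ineq[of "\<lambda>i. \<rho> * norm (x - xs) * Lg i d" "\<lambda>i. \<bar>lam i - ls i\<bar>" "{..<mI}"] by simp
  also have "L2_set (\<lambda>i. \<rho> * norm (x - xs) * Lg i d) {..<mI} = \<rho> * norm (x - xs) * L"
    using \<rho>_pos by (simp add: L_eq L2_set_right_distrib)
  also have "\<rho> * norm (x - xs) * L \<le> \<rho> * L * d"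
    using x \<rho>_pos L_nonneg mult_left_mono[of "norm (x - xs)" d "\<rho> * L"] by (simp add: algebra_simps)
  also have "L2_set (\<lambda>i. \<bar>lam i - ls i\<bar>) {..<mI} \<le> d"
    using lam by (simp add: L2_set_def)
  finally show ?thesis
    by simp
qed

lemma M\<Theta>_nonneg: "M\<Theta> \<ge> 0"
  using \<rho>_pos d_nonneg L_nonneg by (simp add: M\<Theta>_def M_Theta_def sum_nonneg)

lemma curvature_error_bound:
  assumes x: "norm (x - xs) \<le> d" and lam: "L2_set (\<lambda>i. lam i - ls i) {..<mI} \<le> d"
  shows "norm (curvature_error x lam) \<le> M\<Theta> * norm (x - xs)"
proof -
  let ?M = "L2_set (\<lambda>i. Mg i d) {..<mI}"
  have "norm (curvature_error x lam) \<le> (\<Sum>i<mI. \<bar>u x lam i\<bar> * \<bar>Mg i d\<bar> * norm (x - xs))"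
    unfolding curvature_error_def
  proof (rule order_trans[OF norm_sum], rule sum_mono)
    fix i assume "i \<in> {..<mI}"
    then have "\<bar>u x lam i\<bar> * norm (dg i x - dg i xs) \<le> \<bar>u x lam i\<bar> * (\<bar>Mg i d\<bar> * norm (x - xs))"
      using dg_lipschitz[of i x] x Mg_nonneg[of i] by (intro mult_left_mono) auto
    then show "norm (if g i xs = 0 then u x lam i *\<^sub>R (dg i x - dg i xs) else 0)
        \<le> \<bar>u x lam i\<bar> * \<bar>Mg i d\<bar> * norm (x - xs)"
      by (auto simp: mult.assoc)
  qed
  also have "\<dots> = (\<Sum>i<mI. \<bar>u x lam i\<bar> * \<bar>Mg i d\<bar>) * norm (x - xs)"
    by (simp add: sum_distrib_right)
  also have "\<dots> \<le> (L2_set (u x lam) {..<mI} * ?M) * norm (x - xs)"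
    by (intro mult_right_mono L2_set_mult_ineq) auto
  also have "\<dots> \<le> ((\<rho> * L * d + d + L2_set ls {..<mI}) * ?M) * norm (x - xs)"
    using u_L2_bound[OF x lam] by (intro mult_right_mono) auto
  also have "\<dots> \<le> M\<Theta> * norm (x - xs)"
    using \<rho>_pos by (intro mult_right_mono) (auto simp: M\<Theta>_def M_Theta_def L2_set_def)
  finally show ?thesis .
qed

lemma A_bound: "(\<Sum>j<mE. (A j \<bullet> h)\<^sup>2) \<le> a\<^sup>2 * (norm h)\<^sup>2"
proof -
  have "(L2_set (\<lambda>j. A j \<bullet> h) {..<mE})\<^sup>2 \<le> (a * norm h)\<^sup>2"
    using spectral_norm_bound[of A h mE] by (intro power_mono) (auto simp: a_def)
  then show ?thesis
    by (simp add: L2_set_def sum_nonneg power_mult_distrib)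
qed

lemma act_rows_bound: "(\<Sum>i\<in>act. (dg i xs \<bullet> h)\<^sup>2) \<le> L\<^sup>2 * (norm h)\<^sup>2"
proof -
  have "(\<Sum>i\<in>act. (dg i xs \<bullet> h)\<^sup>2) \<le> (\<Sum>i<mI. (Lg i d)\<^sup>2 * (norm h)\<^sup>2)"
    unfolding sum_act
  proof (rule sum_mono)
    fix i assume "i \<in> {..<mI}"
    then have "\<bar>dg i xs \<bullet> h\<bar> \<le> Lg i d * norm h"
      using Cauchy_Schwarz_ineq2[of "dg i xs" h] mult_right_mono[OF dg_bound[of i xs], of "norm h"] d_nonneg by fastforce
    then have "\<bar>dg i xs \<bullet> h\<bar>\<^sup>2 \<le> (Lg i d * norm h)\<^sup>2"
      by (intro power_mono) auto
    then show "(if g i xs = 0 then (dg i xs \<bullet> h)\<^sup>2 else 0) \<le> (Lg i d)\<^sup>2 * (norm h)\<^sup>2"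
      by (auto simp: power_mult_distrib)
  qed
  also have "\<dots> = L\<^sup>2 * (norm h)\<^sup>2"
    by (simp add: L_def sum_nonneg sum_distrib_right)
  finally show ?thesis .
qed

lemma \<kappa>_pos: "\<kappa> > 0"
  unfolding \<kappa>_def by (rule kappa_pos_and_le(1)[OF licq])

lemma \<kappa>_pull: "\<kappa> * ((\<Sum>i\<in>act. (y i)\<^sup>2) + (\<Sum>j<mE. (v j)\<^sup>2)) \<le> (norm (pull y v))\<^sup>2"
  unfolding \<kappa>_def pull_def act_def by (rule kappa_pos_and_le(2)[OF licq])

lemma finite_act: "finite act"
  by (simp add: act_def)

text \<open>
  Test the form on a single row, which exists by LICQ. The lemma is stated for an arbitrary bound because it is
  applied both to the bound by \<open>L\<close> and \<open>a\<close> and to the Frobenius norm of the rows.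
\<close>

lemma \<kappa>_le_of_row_bound:
  assumes C: "\<And>h. (\<Sum>i\<in>act. (dg i xs \<bullet> h)\<^sup>2) + (\<Sum>j<mE. (A j \<bullet> h)\<^sup>2) \<le> C * (norm h)\<^sup>2"
  shows "\<kappa> \<le> C"
proof -
  have row: "\<kappa> \<le> C" if k: "\<kappa> \<le> (norm r)\<^sup>2"
    and r: "(r \<bullet> r)\<^sup>2 \<le> (\<Sum>i\<in>act. (dg i xs \<bullet> r)\<^sup>2) + (\<Sum>j<mE. (A j \<bullet> r)\<^sup>2)" for r
  proof -
    have "(norm r)\<^sup>2 * (norm r)\<^sup>2 \<le> C * (norm r)\<^sup>2"
      using order_trans[OF r C] unfolding power2_norm_eq_inner by (simp only: power2_eq_square)
    moreover have "(norm r)\<^sup>2 > 0"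
      using k \<kappa>_pos by linarith
    ultimately show ?thesis
      using k mult_right_le_imp_le[of "(norm r)\<^sup>2" "(norm r)\<^sup>2" C] by linarith
  qed
  have "card act > 0 \<or> mE > 0"
    using licq by (auto simp: LICQ_def act_def)
  then show ?thesis
  proof
    assume "card act > 0"
    then obtain i where i: "i \<in> act"
      by (metis all_not_in_conv card.empty less_irrefl)
    show ?thesis
    proof (rule row[of "dg i xs"])
      show "\<kappa> \<le> (norm (dg i xs))\<^sup>2"
        using \<kappa>_pull[of "\<lambda>k. if k = i then 1 else 0" "\<lambda>_. 0"] i finite_act
        by (simp add: pull_def if_distrib[of "\<lambda>x. x\<^sup>2"] if_distrib[of "\<lambda>x. x *\<^sub>R _"] cong: if_cong)
      have "(dg i xs \<bullet> dg i xs)\<^sup>2 \<le> (\<Sum>k\<in>act. (dg k xs \<bullet> dg i xs)\<^sup>2)"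
        using i finite_act by (intro member_le_sum[of i act "\<lambda>k. (dg k xs \<bullet> dg i xs)\<^sup>2"]) auto
      then show "(dg i xs \<bullet> dg i xs)\<^sup>2 \<le> (\<Sum>k\<in>act. (dg k xs \<bullet> dg i xs)\<^sup>2) + (\<Sum>j<mE. (A j \<bullet> dg i xs)\<^sup>2)"
        by (simp add: add_increasing2 sum_nonneg)
    qed
  next
    assume j: "mE > 0"
    show ?thesis
    proof (rule row[of "A 0"])
      show "\<kappa> \<le> (norm (A 0))\<^sup>2"
        using \<kappa>_pull[of "\<lambda>_. 0" "\<lambda>k. if k = 0 then 1 else 0"] j
        by (simp add: pull_def if_distrib[of "\<lambda>x. x\<^sup>2"] if_distrib[of "\<lambda>x. x *\<^sub>R _"] cong: if_cong)
      have "(A 0 \<bullet> A 0)\<^sup>2 \<le> (\<Sum>k<mE. (A k \<bullet> A 0)\<^sup>2)"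
        using j by (intro member_le_sum[of 0 "{..<mE}" "\<lambda>k. (A k \<bullet> A 0)\<^sup>2"]) auto
      then show "(A 0 \<bullet> A 0)\<^sup>2 \<le> (\<Sum>i\<in>act. (dg i xs \<bullet> A 0)\<^sup>2) + (\<Sum>k<mE. (A k \<bullet> A 0)\<^sup>2)"
        by (simp add: add_increasing sum_nonneg)
    qed
  qed
qed

lemma rows_bound: "(\<Sum>i\<in>act. (dg i xs \<bullet> h)\<^sup>2) + (\<Sum>j<mE. (A j \<bullet> h)\<^sup>2) \<le> (L\<^sup>2 + a\<^sup>2) * (norm h)\<^sup>2"
  using A_bound[of h] act_rows_bound[of h] by (simp add: algebra_simps)

lemma \<kappa>_le: "\<kappa> \<le> L\<^sup>2 + a\<^sup>2"
  by (rule \<kappa>_le_of_row_bound) (rule rows_bound)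

text \<open>
  Young's inequality with weight \<open>C\<close>, which is nonzero because \<open>C\<^sup>2 \<ge> \<kappa>\<close>.
\<close>

lemma cross_term_bound:
  assumes C: "\<And>h. (\<Sum>i\<in>act. (dg i xs \<bullet> h)\<^sup>2) + (\<Sum>j<mE. (A j \<bullet> h)\<^sup>2) \<le> C\<^sup>2 * (norm h)\<^sup>2" and "C \<ge> 0"
  shows "\<bar>h \<bullet> pull y v\<bar> \<le> C / 2 * ((norm h)\<^sup>2 + (\<Sum>i<mI. (y i)\<^sup>2) + (\<Sum>j<mE. (v j)\<^sup>2))"
proof -
  have "C\<^sup>2 > 0"
    using \<kappa>_le_of_row_bound[OF C] \<kappa>_pos by linarith
  then have Cpos: "C > 0"
    using \<open>C \<ge> 0\<close> by (cases "C = 0") auto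
  have young: "C * \<bar>p * q\<bar> \<le> (C\<^sup>2 * p\<^sup>2 + q\<^sup>2) / 2" for p q :: real
    using zero_le_power2[of "C * \<bar>p\<bar> - \<bar>q\<bar>"] by (simp add: power2_diff power_mult_distrib abs_mult)
  have "h \<bullet> pull y v = (\<Sum>i\<in>act. y i * (dg i xs \<bullet> h)) + (\<Sum>j<mE. v j * (A j \<bullet> h))"
    by (simp add: pull_def inner_add_right inner_sum_right inner_commute)
  then have "\<bar>h \<bullet> pull y v\<bar> \<le> (\<Sum>i\<in>act. \<bar>y i * (dg i xs \<bullet> h)\<bar>) + (\<Sum>j<mE. \<bar>v j * (A j \<bullet> h)\<bar>)"
    using sum_abs[of "\<lambda>i. y i * (dg i xs \<bullet> h)" act] sum_abs[of "\<lambda>j. v j * (A j \<bullet> h)" "{..<mE}"] by linarith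
  then have "C * \<bar>h \<bullet> pull y v\<bar> \<le> C * ((\<Sum>i\<in>act. \<bar>y i * (dg i xs \<bullet> h)\<bar>) + (\<Sum>j<mE. \<bar>v j * (A j \<bullet> h)\<bar>))"
    using Cpos by (intro mult_left_mono) auto
  also have "\<dots> = (\<Sum>i\<in>act. C * \<bar>y i * (dg i xs \<bullet> h)\<bar>) + (\<Sum>j<mE. C * \<bar>v j * (A j \<bullet> h)\<bar>)"
    by (simp add: sum_distrib_left distrib_left)
  also have "\<dots> \<le> (\<Sum>i\<in>act. (C\<^sup>2 * (y i)\<^sup>2 + (dg i xs \<bullet> h)\<^sup>2) / 2) + (\<Sum>j<mE. (C\<^sup>2 * (v j)\<^sup>2 + (A j \<bullet> h)\<^sup>2) / 2)"
    by (intro add_mono sum_mono young)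
  also have "\<dots> = (C\<^sup>2 * (\<Sum>i\<in>act. (y i)\<^sup>2) + C\<^sup>2 * (\<Sum>j<mE. (v j)\<^sup>2)
      + ((\<Sum>i\<in>act. (dg i xs \<bullet> h)\<^sup>2) + (\<Sum>j<mE. (A j \<bullet> h)\<^sup>2))) / 2"
    by (simp add: sum.distrib sum_distrib_left sum_divide_distrib[symmetric] add_divide_distrib)
  also have "\<dots> \<le> (C\<^sup>2 * (\<Sum>i<mI. (y i)\<^sup>2) + C\<^sup>2 * (\<Sum>j<mE. (v j)\<^sup>2) + C\<^sup>2 * (norm h)\<^sup>2) / 2"
  proof -
    have "(\<Sum>i\<in>act. (y i)\<^sup>2) \<le> (\<Sum>i<mI. (y i)\<^sup>2)"
      by (intro sum_mono2) (auto simp: act_def)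
    then show ?thesis
      using C[of h] by (intro divide_right_mono add_mono mult_left_mono) auto
  qed
  also have "\<dots> = C * (C / 2 * ((norm h)\<^sup>2 + (\<Sum>i<mI. (y i)\<^sup>2) + (\<Sum>j<mE. (v j)\<^sup>2)))"
    by (simp add: power2_eq_square algebra_simps)
  finally show ?thesis
    using Cpos by simp
qed

lemma pull_derivative_bound:
  assumes x: "norm (x - xs) \<le> d"
  shows "(x - xs) \<bullet> pull (ldot x lam) (ndot x)
    \<le> a\<^sup>2 * (norm (x - xs))\<^sup>2 + norm (x - xs) * L * sqrt (\<Sum>i<mI. diss x lam i) / \<rho>"
proof -
  let ?X = "x - xs"
  have "(\<Sum>j<mE. ndot x j * (A j \<bullet> ?X)) = (\<Sum>j<mE. (A j \<bullet> ?X)\<^sup>2)"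
    by (intro sum.cong) (auto simp: ndot_def feasible_xs(2)[symmetric] inner_diff_right power2_eq_square)
  moreover have "(\<Sum>i\<in>act. ldot x lam i * (dg i xs \<bullet> ?X)) \<le> norm ?X * L * sqrt (\<Sum>i<mI. diss x lam i) / \<rho>"
  proof -
    have "(\<Sum>i\<in>act. ldot x lam i * (dg i xs \<bullet> ?X)) \<le> (\<Sum>i<mI. Lg i d * \<bar>u x lam i - lam i\<bar> * (norm ?X / \<rho>))"
      unfolding sum_act
    proof (rule sum_mono)
      fix i assume i: "i \<in> {..<mI}"
      have "\<bar>dg i xs \<bullet> ?X\<bar> \<le> Lg i d * norm ?X"
        using Cauchy_Schwarz_ineq2[of "dg i xs" ?X] mult_right_mono[OF dg_bound[of i xs], of "norm ?X"] d_nonneg i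
        by fastforce
      then have "\<bar>ldot x lam i\<bar> * \<bar>dg i xs \<bullet> ?X\<bar> \<le> \<bar>ldot x lam i\<bar> * (Lg i d * norm ?X)"
        by (rule mult_left_mono) simp
      also have "\<dots> = Lg i d * \<bar>u x lam i - lam i\<bar> * (norm ?X / \<rho>)"
        using \<rho>_pos by (simp add: ldot_def)
      finally have bd: "\<bar>ldot x lam i\<bar> * \<bar>dg i xs \<bullet> ?X\<bar> \<le> Lg i d * \<bar>u x lam i - lam i\<bar> * (norm ?X / \<rho>)" .
      have "ldot x lam i * (dg i xs \<bullet> ?X) \<le> \<bar>ldot x lam i\<bar> * \<bar>dg i xs \<bullet> ?X\<bar>"
        by (metis abs_ge_self abs_mult)
      moreover have "0 \<le> \<bar>ldot x lam i\<bar> * \<bar>dg i xs \<bullet> ?X\<bar>"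
        by simp
      ultimately have "ldot x lam i * (dg i xs \<bullet> ?X) \<le> Lg i d * \<bar>u x lam i - lam i\<bar> * (norm ?X / \<rho>)"
        "0 \<le> Lg i d * \<bar>u x lam i - lam i\<bar> * (norm ?X / \<rho>)"
        using bd by linarith+
      then show "(if g i xs = 0 then ldot x lam i * (dg i xs \<bullet> ?X) else 0)
          \<le> Lg i d * \<bar>u x lam i - lam i\<bar> * (norm ?X / \<rho>)"
        by (cases "g i xs = 0") simp_all
    qed
    also have "\<dots> = (\<Sum>i<mI. Lg i d * \<bar>u x lam i - lam i\<bar>) * (norm ?X / \<rho>)"
      by (rule sum_distrib_right[symmetric])
    also have "\<dots> \<le> (L * sqrt (1 * (\<Sum>i<mI. diss x lam i))) * (norm ?X / \<rho>)"
      using \<rho>_pos diss_ge_sq by (intro mult_right_mono L2_increments) auto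
    finally show ?thesis
      by (simp add: ac_simps)
  qed
  ultimately show ?thesis
    using A_bound[of ?X] by (simp add: pull_def inner_add_right inner_sum_right inner_commute)
qed

end

section \<open>Exponential decay of a Lyapunov function\<close>

text \<open>
  Gronwall's inequality, with one-sided derivatives at the initial time.
\<close>

lemma exponential_decay:
  fixes h h' :: "real \<Rightarrow> real"
  assumes der: "\<And>t. t \<ge> 0 \<Longrightarrow> (h has_real_derivative h' t) (at t within {0..})"
    and le: "\<And>t. t \<ge> 0 \<Longrightarrow> h' t \<le> - c * h t" and t: "t \<ge> 0"
  shows "h t \<le> exp (- c * t) * h 0"
proof -
  define k where "k = (\<lambda>s. exp (c * s) * h s)"
  have k: "(k has_real_derivative exp (c * s) * (c * h s + h' s)) (at s within {0..})" if "s \<ge> 0" for s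
    unfolding k_def by (auto intro!: derivative_eq_intros der[OF that] simp: algebra_simps)
  have "k t \<le> k 0"
  proof (rule DERIV_nonpos_imp_decreasing_open[OF t])
    fix s :: real assume s: "0 < s" "s < t"
    have "(k has_real_derivative exp (c * s) * (c * h s + h' s)) (at s)"
      using k[of s] s at_within_interior[of s "{0::real..}"] by simp
    moreover have "exp (c * s) * (c * h s + h' s) \<le> 0"
      using le[of s] s by (intro mult_nonneg_nonpos) auto
    ultimately show "\<exists>y. DERIV k s :> y \<and> y \<le> 0"
      by blast
  next
    have "continuous_on {0..} k"
      using k DERIV_continuous unfolding continuous_on_eq_continuous_within by fastforce
    then show "continuous_on {0..t} k"
      by (rule continuous_on_subset) auto
  qed
  then have "exp (- c * t) * (exp (c * t) * h t) \<le> exp (- c * t) * h 0"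
    by (intro mult_left_mono) (auto simp: k_def)
  then show ?thesis
    by (simp add: mult.assoc[symmetric] exp_add[symmetric])
qed

lemma has_real_derivative_inner:
  fixes p q :: "real \<Rightarrow> 'a :: real_inner"
  assumes "(p has_vector_derivative p') (at t within S)" "(q has_vector_derivative q') (at t within S)"
  shows "((\<lambda>t. p t \<bullet> q t) has_real_derivative (p t \<bullet> q' + p' \<bullet> q t)) (at t within S)"
  using bounded_bilinear.has_vector_derivative[OF bounded_bilinear_inner assms]
  by (simp add: has_real_derivative_iff_has_vector_derivative)

context augmented_dynamics
begin

definition pairing_rate :: "real^'n \<Rightarrow> (nat \<Rightarrow> real) \<Rightarrow> (nat \<Rightarrow> real) \<Rightarrow> real" where
  "pairing_rate x lam nu = (x - xs) \<bullet> pull (ldot x lam) (ndot x)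
     + xdot x lam nu \<bullet> pull (\<lambda>i. lam i - ls i) (\<lambda>j. nu j - ns j)"

definition energy_rate :: "real^'n \<Rightarrow> (nat \<Rightarrow> real) \<Rightarrow> (nat \<Rightarrow> real) \<Rightarrow> real" where
  "energy_rate x lam nu = (x - xs) \<bullet> xdot x lam nu + (\<Sum>i<mI. (lam i - ls i) * ldot x lam i)
     + (\<Sum>j<mE. (nu j - ns j) * ndot x j)"

definition sqdist :: "real^'n \<Rightarrow> (nat \<Rightarrow> real) \<Rightarrow> (nat \<Rightarrow> real) \<Rightarrow> real" where
  "sqdist x lam nu = (norm (x - xs))\<^sup>2 + (\<Sum>i<mI. (lam i - ls i)\<^sup>2) + (\<Sum>j<mE. (nu j - ns j)\<^sup>2)"

definition rate_conditions :: "real \<Rightarrow> bool" where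
  "rate_conditions \<beta> \<longleftrightarrow> \<beta> > 0 \<and> \<beta> \<le> \<kappa> * \<delta> / (46 * \<rho> * (L\<^sup>2 + a\<^sup>2)) \<and>
     \<kappa> * \<mu> / (4 * \<beta>) - 4 * \<beta>\<^sup>2
       \<ge> a\<^sup>2 + L\<^sup>2 + \<kappa> / 4 + (l + M\<Theta>) * (\<mu> + M\<Theta> + 1 / \<rho>) + 1 / (2 * \<rho>\<^sup>2)"

text \<open>
  The left-hand side is the derivative along the dynamics of the Lyapunov function
  \<open>\<parallel>z - z\<^sup>*\<parallel>\<^sup>2 / 2 + \<epsilon> \<langle>x - x\<^sup>*, pull\<rangle>\<close> in parentheses on the right. The ball makes the constants of the
  constraint gradients available and, together with \<open>\<lambda> \<ge> 0\<close>, the damping of the inactive multipliers; the rest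
  is the accounting of \<open>dissipation_budget\<close>.
\<close>

lemma lyapunov_decrease:
  assumes \<beta>: "rate_conditions \<beta>" and ball: "sqdist x lam nu \<le> d\<^sup>2" and lam: "\<And>i. i < mI \<Longrightarrow> 0 \<le> lam i"
  defines "\<epsilon> \<equiv> 4 * \<beta> / \<kappa>"
  shows "energy_rate x lam nu + \<epsilon> * pairing_rate x lam nu
    \<le> - 2 * \<beta> * (sqdist x lam nu / 2
        + \<epsilon> * ((x - xs) \<bullet> pull (\<lambda>i. lam i - ls i) (\<lambda>j. nu j - ns j)))"
proof -
  define X where "X = x - xs"
  define p where "p = pull (\<lambda>i. lam i - ls i) (\<lambda>j. nu j - ns j)"
  define e where "e = (\<Sum>i<mI. diss x lam i)"
  define D where "D = df x - df xs"
  define Y where "Y = (\<Sum>i\<in>act. (lam i - ls i)\<^sup>2) + (\<Sum>j<mE. (nu j - ns j)\<^sup>2)"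
  define Yi where "Yi = (\<Sum>i<mI. if g i xs = 0 then 0 else (lam i)\<^sup>2)"
  have \<epsilon>: "\<epsilon> > 0"
    using \<beta> \<kappa>_pos by (simp add: \<epsilon>_def rate_conditions_def)
  have lam_sum: "(\<Sum>i<mI. (lam i - ls i)\<^sup>2) = (\<Sum>i\<in>act. (lam i - ls i)\<^sup>2) + Yi"
    unfolding sum_act Yi_def sum.distrib[symmetric] using complementary by (intro sum.cong) auto
  then have dist: "sqdist x lam nu = (norm X)\<^sup>2 + Y + Yi"
    by (simp add: sqdist_def X_def Y_def)
  have nonneg: "0 \<le> (\<Sum>i<mI. (lam i - ls i)\<^sup>2)" "0 \<le> (\<Sum>j<mE. (nu j - ns j)\<^sup>2)"
    by (auto intro: sum_nonneg)
  have "(norm X)\<^sup>2 \<le> d\<^sup>2"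
    using ball nonneg unfolding sqdist_def X_def by linarith
  then have x_ball: "norm (x - xs) \<le> d"
    using d_nonneg by (simp add: X_def abs_le_square_iff[symmetric])
  have "(\<Sum>i<mI. (lam i - ls i)\<^sup>2) \<le> d\<^sup>2"
    using ball nonneg zero_le_power2[of "norm (x - xs)"] unfolding sqdist_def by linarith
  then have lam_ball: "L2_set (\<lambda>i. lam i - ls i) {..<mI} \<le> d"
    using d_nonneg by (simp add: L2_set_def real_le_lsqrt)
  have lam_d: "lam i - ls i \<le> d" if "i < mI" for i
    using member_le_L2_set[of "{..<mI}" i "\<lambda>i. lam i - ls i"] that lam_ball by simp
  have e: "e \<ge> 0"
    unfolding e_def using diss_nonneg by (intro sum_nonneg) auto
  have Yi: "Yi \<le> 2 / \<delta> * e"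
    unfolding Yi_def e_def sum_distrib_left
  proof (rule sum_mono)
    fix i assume "i \<in> {..<mI}"
    then have i: "i < mI"
      by simp
    show "(if g i xs = 0 then 0 else (lam i)\<^sup>2) \<le> 2 / \<delta> * diss x lam i"
      using inactive_diss(1)[OF i, of lam x] lam[OF i] lam_d[OF i] complementary[OF i] diss_nonneg[OF i, of x lam] \<delta>_pos
      by auto
  qed
  have budget: "- (X \<bullet> D) - e / \<rho> + \<epsilon> * (a\<^sup>2 * (norm X)\<^sup>2 + norm X * L * sqrt e / \<rho> - (norm p)\<^sup>2
      + norm p * norm D + norm p * norm (coupling_error x lam) + norm p * norm (curvature_error x lam))
    + \<beta> * ((norm X)\<^sup>2 + Y + Yi) + 2 * \<beta> * \<epsilon> * (norm X * norm p) \<le> 0"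
    unfolding \<epsilon>_def
  proof (rule dissipation_budget[where \<mu> = \<mu> and l = l and M = M\<Theta>])
    show "\<mu> * (norm X)\<^sup>2 \<le> X \<bullet> D" "(norm D)\<^sup>2 \<le> l * (X \<bullet> D)" "norm D \<le> l * norm X"
      using f_monotone df_cocoercive df_lipschitz by (auto simp: X_def D_def)
    show "norm (curvature_error x lam) \<le> M\<Theta> * norm X"
      unfolding X_def by (rule curvature_error_bound[OF x_ball lam_ball])
    show "(norm (coupling_error x lam))\<^sup>2 \<le> L\<^sup>2 * (6 / \<delta>) * e"
      unfolding e_def by (rule coupling_error_bound[OF x_ball lam lam_d])
    show "\<kappa> * Y \<le> (norm p)\<^sup>2"
      unfolding Y_def p_def by (rule \<kappa>_pull)
  qed (use \<beta> \<mu>_le_l \<mu>_pos \<rho>_pos \<kappa>_pos \<kappa>_le M\<Theta>_nonneg \<delta>_pos \<delta>_le_1 e Yi in \<open>auto simp: rate_conditions_def\<close>)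
  have "energy_rate x lam nu \<le> - (X \<bullet> D) - e / \<rho>"
    using energy_dissipation[of x lam nu] by (simp add: energy_rate_def X_def D_def e_def)
  moreover have "pairing_rate x lam nu \<le> a\<^sup>2 * (norm X)\<^sup>2 + norm X * L * sqrt e / \<rho> - (norm p)\<^sup>2
      + norm p * norm D + norm p * norm (coupling_error x lam) + norm p * norm (curvature_error x lam)"
  proof -
    have "xdot x lam nu \<bullet> p = - (norm p)\<^sup>2 + (- D) \<bullet> p + (- coupling_error x lam) \<bullet> p + (- curvature_error x lam) \<bullet> p"
      unfolding xdot_decomposition p_def[symmetric] D_def[symmetric]
      by (simp add: inner_diff_left power2_norm_eq_inner)
    moreover have "(- v) \<bullet> p \<le> norm p * norm v" for v
      using norm_cauchy_schwarz[of "- v" p] by (simp add: mult.commute)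
    ultimately have "xdot x lam nu \<bullet> p \<le> - (norm p)\<^sup>2 + norm p * norm D + norm p * norm (coupling_error x lam)
        + norm p * norm (curvature_error x lam)"
      by (smt (verit))
    then show ?thesis
      using pull_derivative_bound[OF x_ball, of lam] by (simp add: pairing_rate_def p_def X_def e_def)
  qed
  then have "\<epsilon> * pairing_rate x lam nu \<le> \<epsilon> * (a\<^sup>2 * (norm X)\<^sup>2 + norm X * L * sqrt e / \<rho> - (norm p)\<^sup>2
      + norm p * norm D + norm p * norm (coupling_error x lam) + norm p * norm (curvature_error x lam))"
    using \<epsilon> by (intro mult_left_mono) auto
  moreover have "2 * \<beta> * \<epsilon> * (X \<bullet> p) \<le> 2 * \<beta> * \<epsilon> * (norm X * norm p)"
    using \<epsilon> \<beta> norm_cauchy_schwarz[of X p] by (intro mult_left_mono) (auto simp: rate_conditions_def)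
  moreover have "- 2 * \<beta> * (sqdist x lam nu / 2 + \<epsilon> * (X \<bullet> p)) = - (\<beta> * ((norm X)\<^sup>2 + Y + Yi)) - 2 * \<beta> * \<epsilon> * (X \<bullet> p)"
    by (simp add: dist algebra_simps add_divide_distrib diff_divide_distrib)
  ultimately show ?thesis
    using budget unfolding X_def p_def by linarith
qed

definition row_norm :: real where
  "row_norm = sqrt ((\<Sum>i\<in>act. (norm (dg i xs))\<^sup>2) + (\<Sum>j<mE. (norm (A j))\<^sup>2))"

text \<open>
  Relative deviation of the Lyapunov function from half the squared distance. The formula involves only
  \<open>\<beta>\<close> and the rows at the optimum, not \<open>\<rho>\<close>, \<open>\<mu>\<close> or the Lipschitz constants, as the factor \<open>M\<^sub>\<beta>\<close> must
  be chosen before those are known.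
\<close>

definition skew :: "real \<Rightarrow> real" where
  "skew \<beta> = min (1 / 2) (4 * \<beta> * row_norm / \<kappa>)"

lemma frobenius_bound:
  "(\<Sum>i\<in>act. (dg i xs \<bullet> h)\<^sup>2) + (\<Sum>j<mE. (A j \<bullet> h)\<^sup>2) \<le> row_norm\<^sup>2 * (norm h)\<^sup>2"
proof -
  have "(r \<bullet> h)\<^sup>2 \<le> (norm r)\<^sup>2 * (norm h)\<^sup>2" for r :: "real^'n"
    using Cauchy_Schwarz_ineq[of r h] by (simp add: power2_norm_eq_inner)
  then have "(\<Sum>i\<in>act. (dg i xs \<bullet> h)\<^sup>2) + (\<Sum>j<mE. (A j \<bullet> h)\<^sup>2)
      \<le> (\<Sum>i\<in>act. (norm (dg i xs))\<^sup>2 * (norm h)\<^sup>2) + (\<Sum>j<mE. (norm (A j))\<^sup>2 * (norm h)\<^sup>2)"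
    by (intro add_mono sum_mono)
  then show ?thesis
    by (simp add: row_norm_def sum_nonneg sum_distrib_right distrib_right)
qed

text \<open>
  Two bounds of the cross term: the Frobenius norm of the rows gives one that vanishes with \<open>\<beta>\<close>. It may be
  large for large \<open>\<beta>\<close>, but then the second condition on \<open>\<beta>\<close> gives the other, namely
  \<open>\<epsilon> sqrt (L\<^sup>2 + a\<^sup>2) \<le> 1 / 2\<close>, since \<open>L\<^sup>2 + a\<^sup>2 + l \<mu> \<ge> 2 \<mu> sqrt (L\<^sup>2 + a\<^sup>2)\<close> for \<open>l \<ge> \<mu>\<close>.
\<close>

lemma lyapunov_equivalent:
  assumes \<beta>: "rate_conditions \<beta>"
  defines "\<epsilon> \<equiv> 4 * \<beta> / \<kappa>"
  shows "\<bar>\<epsilon> * ((x - xs) \<bullet> pull (\<lambda>i. lam i - ls i) (\<lambda>j. nu j - ns j))\<bar> \<le> skew \<beta> / 2 * sqdist x lam nu"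
proof -
  let ?c = "(x - xs) \<bullet> pull (\<lambda>i. lam i - ls i) (\<lambda>j. nu j - ns j)"
  have \<epsilon>: "\<epsilon> > 0"
    using \<beta> \<kappa>_pos by (simp add: \<epsilon>_def rate_conditions_def)
  have sq: "sqdist x lam nu \<ge> 0"
    by (simp add: sqdist_def sum_nonneg)
  define K where "K = sqrt (L\<^sup>2 + a\<^sup>2)"
  have K: "K \<ge> 0" "K\<^sup>2 = L\<^sup>2 + a\<^sup>2"
    by (auto simp: K_def)
  have scale: "\<bar>\<epsilon> * ?c\<bar> \<le> \<epsilon> * C / 2 * sqdist x lam nu"
    if "\<And>h. (\<Sum>i\<in>act. (dg i xs \<bullet> h)\<^sup>2) + (\<Sum>j<mE. (A j \<bullet> h)\<^sup>2) \<le> C\<^sup>2 * (norm h)\<^sup>2" "C \<ge> 0" for C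
    using mult_left_mono[OF cross_term_bound[OF that, of "x - xs" "\<lambda>i. lam i - ls i" "\<lambda>j. nu j - ns j"], of \<epsilon>] \<epsilon>
    by (simp add: sqdist_def abs_mult mult.assoc)
  have "\<epsilon> * K \<le> 1 / 2"
  proof -
    have "\<mu> / \<epsilon> = \<kappa> * \<mu> / (4 * \<beta>)"
      by (simp add: \<epsilon>_def)
    moreover have "0 \<le> (\<mu> + M\<Theta> + 1 / \<rho>) * M\<Theta>" "l * \<mu> \<le> l * (\<mu> + M\<Theta> + 1 / \<rho>)"
      using \<mu>_pos \<mu>_le_l \<rho>_pos M\<Theta>_nonneg by (auto intro!: mult_left_mono)
    then have "l * \<mu> \<le> (l + M\<Theta>) * (\<mu> + M\<Theta> + 1 / \<rho>)"
      by (simp add: algebra_simps)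
    moreover have "0 \<le> 1 / (2 * \<rho>\<^sup>2)" "0 \<le> 4 * \<beta>\<^sup>2"
      by auto
    ultimately have "K\<^sup>2 + l * \<mu> \<le> \<mu> / \<epsilon>"
      using \<beta> \<kappa>_pos K(2) unfolding rate_conditions_def by linarith
    moreover have "2 * \<mu> * K \<le> K\<^sup>2 + \<mu> * \<mu>"
      using zero_le_power2[of "K - \<mu>"] by (simp add: power2_eq_square algebra_simps)
    moreover have "\<mu> * \<mu> \<le> l * \<mu>"
      using \<mu>_le_l \<mu>_pos by (intro mult_right_mono) auto
    ultimately have "2 * \<mu> * K \<le> \<mu> / \<epsilon>"
      by linarith
    then have "\<mu> * (2 * (\<epsilon> * K)) \<le> \<mu> * 1"
      using \<epsilon> by (simp add: le_divide_eq algebra_simps)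
    then show ?thesis
      using \<mu>_pos by simp
  qed
  then have "\<epsilon> * K / 2 * sqdist x lam nu \<le> (1 / 2) / 2 * sqdist x lam nu"
    using sq by (intro mult_right_mono divide_right_mono) auto
  moreover have "\<bar>\<epsilon> * ?c\<bar> \<le> \<epsilon> * K / 2 * sqdist x lam nu"
    using rows_bound K by (intro scale) auto
  ultimately have half: "\<bar>\<epsilon> * ?c\<bar> \<le> (1 / 2) / 2 * sqdist x lam nu"
    by linarith
  have "\<bar>\<epsilon> * ?c\<bar> \<le> \<epsilon> * row_norm / 2 * sqdist x lam nu"
    by (rule scale[OF frobenius_bound]) (simp add: row_norm_def sum_nonneg)
  moreover have "\<epsilon> * row_norm = 4 * \<beta> * row_norm / \<kappa>"
    by (simp add: \<epsilon>_def)
  moreover have "skew \<beta> = 1 / 2 \<or> skew \<beta> = 4 * \<beta> * row_norm / \<kappa>"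
    unfolding skew_def min_def by simp
  ultimately show ?thesis
    using half by metis
qed

lemma skew_range:
  assumes "\<beta> > 0"
  shows "0 \<le> skew \<beta>" "skew \<beta> \<le> 1 / 2"
proof -
  have "0 \<le> row_norm"
    by (simp add: row_norm_def sum_nonneg)
  then show "0 \<le> skew \<beta>" "skew \<beta> \<le> 1 / 2"
    using assms \<kappa>_pos by (auto simp: skew_def)
qed

lemma exponential_convergence:
  assumes traj: "aug_PDGD \<rho> df mI g dg mE A b x lam nu" and lam0: "\<And>i. i < mI \<Longrightarrow> lam 0 i \<ge> 0"
    and d: "d\<^sup>2 = sqdist (x 0) (lam 0) (nu 0)" and \<beta>: "rate_conditions \<beta>" and t: "t \<ge> 0"
  shows "sqrt (sqdist (x t) (lam t) (nu t))
    \<le> sqrt ((1 + skew \<beta>) / (1 - skew \<beta>)) * exp (- \<beta> * t) * sqrt (sqdist (x 0) (lam 0) (nu 0))"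
proof -
  define Z where "Z = (\<lambda>t. sqdist (x t) (lam t) (nu t))"
  define p where "p = (\<lambda>t. pull (\<lambda>i. lam t i - ls i) (\<lambda>j. nu t j - ns j))"
  define \<epsilon> where "\<epsilon> = 4 * \<beta> / \<kappa>"
  have x': "(x has_vector_derivative xdot (x t) (lam t) (nu t)) (at t within {0..})"
    and lam': "i < mI \<Longrightarrow> ((\<lambda>s. lam s i) has_real_derivative ldot (x t) (lam t) i) (at t within {0..})"
    and nu': "j < mE \<Longrightarrow> ((\<lambda>s. nu s j) has_real_derivative ndot (x t) j) (at t within {0..})"
    if "t \<ge> 0" for t i j
    using traj that unfolding aug_PDGD_def xdot_def ldot_def ndot_def u_def by blast+
  have X': "((\<lambda>t. x t - xs) has_vector_derivative xdot (x t) (lam t) (nu t)) (at t within {0..})" if "t \<ge> 0" for t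
    using has_vector_derivative_diff[OF x'[OF that] has_vector_derivative_const[of xs]] by simp
  have Z': "((\<lambda>t. Z t / 2) has_real_derivative energy_rate (x t) (lam t) (nu t)) (at t within {0..})" if t: "t \<ge> 0" for t
  proof -
    have "((\<lambda>t. (x t - xs) \<bullet> (x t - xs)) has_real_derivative 2 * ((x t - xs) \<bullet> xdot (x t) (lam t) (nu t))) (at t within {0..})"
      using has_real_derivative_inner[OF X'[OF t] X'[OF t]] by (simp add: inner_commute)
    moreover have "((\<lambda>t. \<Sum>i<mI. (lam t i - ls i)\<^sup>2) has_real_derivative (\<Sum>i<mI. 2 * ((lam t i - ls i) * ldot (x t) (lam t) i)))
        (at t within {0..})"
      by (intro DERIV_sum) (auto intro!: derivative_eq_intros lam'[OF t])
    moreover have "((\<lambda>t. \<Sum>j<mE. (nu t j - ns j)\<^sup>2) has_real_derivative (\<Sum>j<mE. 2 * ((nu t j - ns j) * ndot (x t) j)))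
        (at t within {0..})"
      by (intro DERIV_sum) (auto intro!: derivative_eq_intros nu'[OF t])
    ultimately have "((\<lambda>t. ((x t - xs) \<bullet> (x t - xs) + (\<Sum>i<mI. (lam t i - ls i)\<^sup>2) + (\<Sum>j<mE. (nu t j - ns j)\<^sup>2)) / 2)
        has_real_derivative (2 * ((x t - xs) \<bullet> xdot (x t) (lam t) (nu t)) + (\<Sum>i<mI. 2 * ((lam t i - ls i) * ldot (x t) (lam t) i))
          + (\<Sum>j<mE. 2 * ((nu t j - ns j) * ndot (x t) j))) / 2) (at t within {0..})"
      by (intro DERIV_add DERIV_cdivide)
    then show ?thesis
      by (simp add: Z_def sqdist_def energy_rate_def power2_norm_eq_inner sum_distrib_left[symmetric] add_divide_distrib)
  qed
  have p': "(p has_vector_derivative pull (ldot (x t) (lam t)) (ndot (x t))) (at t within {0..})" if t: "t \<ge> 0" for t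
  proof -
    have "((\<lambda>t. (lam t i - ls i) *\<^sub>R dg i xs) has_vector_derivative ldot (x t) (lam t) i *\<^sub>R dg i xs) (at t within {0..})"
      if "i \<in> act" for i
      using that by (auto intro!: derivative_eq_intros lam'[OF t] simp: act_def)
    moreover have "((\<lambda>t. (nu t j - ns j) *\<^sub>R A j) has_vector_derivative ndot (x t) j *\<^sub>R A j) (at t within {0..})"
      if "j < mE" for j
      using that by (auto intro!: derivative_eq_intros nu'[OF t])
    ultimately show ?thesis
      unfolding p_def pull_def by (intro has_vector_derivative_add has_vector_derivative_sum) auto
  qed
  \<comment> \<open>As the positive part is nonnegative, \<open>- \<lambda>\<^sub>i\<close> decays at rate \<open>1 / \<rho>\<close> and so stays nonpositive.\<close>
  have lam_nonneg: "0 \<le> lam t i" if t: "t \<ge> 0" and i: "i < mI" for t i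
  proof -
    have "- lam t i \<le> exp (- (1 / \<rho>) * t) * (- lam 0 i)"
    proof (rule exponential_decay[OF _ _ t])
      fix s :: real assume s: "s \<ge> 0"
      show "((\<lambda>s. - lam s i) has_real_derivative - ldot (x s) (lam s) i) (at s within {0..})"
        by (intro DERIV_minus lam' s i)
      show "- ldot (x s) (lam s) i \<le> - (1 / \<rho>) * (- lam s i)"
        using \<rho>_pos by (simp add: ldot_def u_def divide_right_mono field_simps)
    qed
    moreover have "exp (- (1 / \<rho>) * t) * (- lam 0 i) \<le> 0"
      using lam0[OF i] by (intro mult_nonneg_nonpos) auto
    ultimately show ?thesis
      by linarith
  qed
  \<comment> \<open>The distance never grows, so the constants of the initial ball remain valid.\<close>
  have ball: "Z t \<le> d\<^sup>2" if t: "t \<ge> 0" for t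
  proof -
    have "Z t / 2 \<le> exp (- 0 * t) * (Z 0 / 2)"
    proof (rule exponential_decay[OF Z' _ t])
      fix s :: real assume s: "s \<ge> 0"
      have "0 \<le> (x s - xs) \<bullet> (df (x s) - df xs)"
        using f_monotone[of "x s"] \<mu>_pos by (rule_tac order_trans[rotated]) auto
      moreover have "0 \<le> (\<Sum>i<mI. diss (x s) (lam s) i) / \<rho>"
        using \<rho>_pos diss_nonneg by (intro divide_nonneg_pos sum_nonneg) auto
      ultimately show "energy_rate (x s) (lam s) (nu s) \<le> - 0 * (Z s / 2)"
        using energy_dissipation[of "x s" "lam s" "nu s"] by (simp add: energy_rate_def)
    qed
    then show ?thesis
      by (simp add: d Z_def)
  qed
  have V: "Z t / 2 + \<epsilon> * ((x t - xs) \<bullet> p t) \<le> exp (- (2 * \<beta>) * t) * (Z 0 / 2 + \<epsilon> * ((x 0 - xs) \<bullet> p 0))"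
  proof (rule exponential_decay[OF _ _ t])
    fix s :: real assume s: "s \<ge> 0"
    have "((\<lambda>t. (x t - xs) \<bullet> p t) has_real_derivative pairing_rate (x s) (lam s) (nu s)) (at s within {0..})"
      using has_real_derivative_inner[OF X'[OF s] p'[OF s]] by (simp add: pairing_rate_def p_def)
    then show "((\<lambda>t. Z t / 2 + \<epsilon> * ((x t - xs) \<bullet> p t)) has_real_derivative
        energy_rate (x s) (lam s) (nu s) + \<epsilon> * pairing_rate (x s) (lam s) (nu s)) (at s within {0..})"
      by (intro DERIV_add Z' s DERIV_cmult)
    show "energy_rate (x s) (lam s) (nu s) + \<epsilon> * pairing_rate (x s) (lam s) (nu s)
        \<le> - (2 * \<beta>) * (Z s / 2 + \<epsilon> * ((x s - xs) \<bullet> p s))"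
      using lyapunov_decrease[OF \<beta> ball[OF s, unfolded Z_def] lam_nonneg[OF s]]
      by (simp add: Z_def p_def \<epsilon>_def)
  qed
  define r where "r = skew \<beta>"
  have r: "0 \<le> r" "r \<le> 1 / 2"
    using skew_range \<beta> by (auto simp: r_def rate_conditions_def)
  have eq: "\<bar>\<epsilon> * ((x s - xs) \<bullet> p s)\<bar> \<le> r / 2 * Z s" for s
    unfolding \<epsilon>_def p_def r_def Z_def by (rule lyapunov_equivalent[OF \<beta>])
  have "(1 - r) * Z t / 2 \<le> Z t / 2 + \<epsilon> * ((x t - xs) \<bullet> p t)"
  proof -
    have "(1 - r) * Z t / 2 = Z t / 2 - r / 2 * Z t"
      by (simp add: left_diff_distrib diff_divide_distrib)
    then show ?thesis
      using eq[of t] by linarith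
  qed
  also note V
  also have "exp (- (2 * \<beta>) * t) * (Z 0 / 2 + \<epsilon> * ((x 0 - xs) \<bullet> p 0)) \<le> exp (- (2 * \<beta>) * t) * ((1 + r) * Z 0 / 2)"
  proof (rule mult_left_mono)
    have "(1 + r) * Z 0 / 2 = Z 0 / 2 + r / 2 * Z 0"
      by (simp add: distrib_right add_divide_distrib)
    then show "Z 0 / 2 + \<epsilon> * ((x 0 - xs) \<bullet> p 0) \<le> (1 + r) * Z 0 / 2"
      using eq[of 0] by linarith
  qed simp
  finally have "(1 - r) * Z t / 2 \<le> exp (- (2 * \<beta>) * t) * ((1 + r) * Z 0 / 2)" .
  moreover have "exp (- (2 * \<beta>) * t) * ((1 + r) * Z 0 / 2) = (1 + r) * exp (- (2 * \<beta>) * t) * Z 0 / 2"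
    by (simp add: ac_simps)
  ultimately have "(1 - r) * Z t \<le> (1 + r) * exp (- (2 * \<beta>) * t) * Z 0"
    by linarith
  then have "Z t \<le> (1 + r) / (1 - r) * exp (- (2 * \<beta>) * t) * Z 0"
    using r by (simp add: field_simps)
  also have "exp (- (2 * \<beta>) * t) = (exp (- \<beta> * t))\<^sup>2"
    by (simp add: power2_eq_square exp_add[symmetric])
  finally have "sqrt (Z t) \<le> sqrt ((1 + r) / (1 - r) * (exp (- \<beta> * t))\<^sup>2 * Z 0)"
    by (rule real_sqrt_le_mono)
  then show ?thesis
    unfolding real_sqrt_mult Z_def r_def by simp
qed

end

section \<open>Semi-global exponential stability\<close>

theorem theorem1:
  fixes f :: "real^'n \<Rightarrow> real" and df :: "real^'n \<Rightarrow> real^'n"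
    and mI :: nat and g :: "nat \<Rightarrow> real^'n \<Rightarrow> real" and dg :: "nat \<Rightarrow> real^'n \<Rightarrow> real^'n"
    and mE :: nat and A :: "nat \<Rightarrow> real^'n" and b :: "nat \<Rightarrow> real"
    and xs :: "real^'n" and ls ns :: "nat \<Rightarrow> real"
  assumes "C1_gradient f df" and "convex_on UNIV f"
    and "\<forall>i<mI. C1_gradient (g i) (dg i) \<and> convex_on UNIV (g i)"
    and "\<exists>x. feasible mI g mE A b x"
    and "optimal_solution f mI g mE A b xs"
    and "LICQ mI g dg mE A xs"
    and "KKT df mI g dg mE A b xs ls ns"
  shows "\<exists>M :: real \<Rightarrow> real.
    (\<forall>\<beta>>0. M \<beta> > 0) \<and> (M \<longlongrightarrow> 1) (at_right 0) \<and>
    (\<forall>\<mu> l \<rho> :: real. \<forall>Lg Mg :: nat \<Rightarrow> real \<Rightarrow> real. \<forall>x lam nu.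
       \<mu> > 0 \<and> strongly_convex \<mu> f \<and> smoothness_constants df mI dg xs l Lg Mg
       \<and> \<rho> > 0 \<and> aug_PDGD \<rho> df mI g dg mE A b x lam nu \<and> (\<forall>i<mI. lam 0 i \<ge> 0) \<longrightarrow>
       (let dist_to_opt = (\<lambda>t. znorm mI mE (x t - xs) (\<lambda>i. lam t i - ls i) (\<lambda>j. nu t j - ns j));
            d0 = dist_to_opt 0;
            \<kappa> = kappa mI g dg mE A xs;
            \<delta> = delta_min \<rho> mI g xs d0;
            L = sqrt (\<Sum>i<mI. (Lg i d0)\<^sup>2);
            M\<Theta> = M_Theta \<rho> L (sqrt (\<Sum>i<mI. (Mg i d0)\<^sup>2)) d0 (L2_set ls {..<mI});
            a = spectral_norm mE A
        in \<forall>\<beta>>0.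
             \<beta> \<le> \<kappa> * \<delta> / (46 * \<rho> * (L\<^sup>2 + a\<^sup>2)) \<and>
             \<kappa> * \<mu> / (4 * \<beta>) - 4 * \<beta>\<^sup>2
               \<ge> a\<^sup>2 + L\<^sup>2 + \<kappa> / 4 + (l + M\<Theta>) * (\<mu> + M\<Theta> + 1 / \<rho>) + 1 / (2 * \<rho>\<^sup>2)
             \<longrightarrow> (\<forall>t\<ge>0. dist_to_opt t \<le> M \<beta> * exp (- \<beta> * t) * dist_to_opt 0)))"
proof -
  define N where "N = sqrt ((\<Sum>i\<in>{i. i < mI \<and> g i xs = 0}. (norm (dg i xs))\<^sup>2) + (\<Sum>j<mE. (norm (A j))\<^sup>2))"
  define r where "r = (\<lambda>\<beta>. min (1 / 2) (4 * \<beta> * N / kappa mI g dg mE A xs))"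
  define M where "M = (\<lambda>\<beta>. sqrt ((1 + r \<beta>) / (1 - r \<beta>)))"
  have \<kappa>: "kappa mI g dg mE A xs > 0"
    by (rule kappa_pos_and_le(1)[OF assms(6)])
  have "M \<beta> > 0" if "\<beta> > 0" for \<beta>
  proof -
    have "0 \<le> r \<beta>" "r \<beta> \<le> 1 / 2"
      using that \<kappa> by (auto simp: r_def N_def sum_nonneg)
    then show ?thesis
      by (simp add: M_def)
  qed
  moreover have "(M \<longlongrightarrow> 1) (at_right 0)"
  proof -
    have "(r \<longlongrightarrow> min (1 / 2) (4 * 0 * N / kappa mI g dg mE A xs)) (at_right 0)"
      unfolding r_def using \<kappa> by (intro tendsto_intros) auto
    then have "(r \<longlongrightarrow> 0) (at_right 0)"
      by simp
    then have "(M \<longlongrightarrow> sqrt ((1 + 0) / (1 - 0))) (at_right 0)"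
      unfolding M_def by (intro tendsto_intros) auto
    then show ?thesis
      by simp
  qed
  moreover have "znorm mI mE (x t - xs) (\<lambda>i. lam t i - ls i) (\<lambda>j. nu t j - ns j) \<le> M \<beta> * exp (- \<beta> * t) * d"
    if hyps: "\<mu> > 0" "strongly_convex \<mu> f" "smoothness_constants df mI dg xs l Lg Mg" "\<rho> > 0"
      and traj: "aug_PDGD \<rho> df mI g dg mE A b x lam nu" and lam0: "\<forall>i<mI. lam 0 i \<ge> 0"
      and d: "d = znorm mI mE (x 0 - xs) (\<lambda>i. lam 0 i - ls i) (\<lambda>j. nu 0 j - ns j)"
      and L: "L = sqrt (\<Sum>i<mI. (Lg i d)\<^sup>2)"
      and M\<Theta>: "M\<Theta> = M_Theta \<rho> L (sqrt (\<Sum>i<mI. (Mg i d)\<^sup>2)) d (L2_set ls {..<mI})"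
      and \<beta>: "\<beta> > 0" "\<beta> \<le> kappa mI g dg mE A xs * delta_min \<rho> mI g xs d / (46 * \<rho> * (L\<^sup>2 + (spectral_norm mE A)\<^sup>2))"
        "kappa mI g dg mE A xs * \<mu> / (4 * \<beta>) - 4 * \<beta>\<^sup>2
          \<ge> (spectral_norm mE A)\<^sup>2 + L\<^sup>2 + kappa mI g dg mE A xs / 4 + (l + M\<Theta>) * (\<mu> + M\<Theta> + 1 / \<rho>) + 1 / (2 * \<rho>\<^sup>2)"
      and t: "t \<ge> 0"
    for \<mu> l \<rho> :: real and Lg Mg x lam nu d L M\<Theta> \<beta> t
  proof -
    have "d \<ge> 0"
      by (simp add: d znorm_def sum_nonneg)
    then interpret augmented_dynamics f df mI g dg mE A b xs ls ns \<mu> l \<rho> Lg Mg d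
      using assms hyps by unfold_locales (auto simp: C1_gradient_def)
    have z: "znorm mI mE (x t - xs) (\<lambda>i. lam t i - ls i) (\<lambda>j. nu t j - ns j) = sqrt (sqdist (x t) (lam t) (nu t))" for t
      by (simp add: znorm_def sqdist_def)
    have rc: "rate_conditions \<beta>"
      using \<beta> unfolding rate_conditions_def \<kappa>_def \<delta>_def a_def M\<Theta>_def local.L_def M\<Theta> L by blast
    have "skew \<beta> = r \<beta>"
      by (simp add: skew_def r_def row_norm_def N_def act_def \<kappa>_def)
    moreover have "d\<^sup>2 = sqdist (x 0) (lam 0) (nu 0)"
      using \<open>d \<ge> 0\<close> unfolding d z by (simp add: sqdist_def sum_nonneg)
    ultimately show ?thesis
      using exponential_convergence[OF traj _ _ rc t] lam0 by (simp add: z M_def d)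
  qed
  ultimately show ?thesis
    unfolding Let_def by (intro exI[of _ M]) blast
qed

end
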